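(* Let $d\ge 1$ and $N\ge d+3$ be integers. Let $f:\mathbb{R}^d\to\mathbb{R}_{\ge 0}$ be $C^2$, and suppose there is $L>0$ with $\sup_{x}\|\nabla^2 f(x)\|\le L$, and there are $\mu>0$ and a compact set outside of which $\nabla^2 f(x)\succeq \mu I_d$. Let $\mathcal{L}$ be the generator of the affine invariant ensemble Langevin dynamics for $f$, and for $a>0$ let $$W_a(\mathbf{X})=\exp\Big(\frac{a}{N}\sum_{i=1}^N f(\mathbf{x}_i)\Big)\,\mathrm{Tr}\big(C(\mathbf{X})^{-1}\big),\qquad \mathbf{X}\in\mathrm{M}.$$ Then for all sufficiently small $a>0$ there exist constants $c>0$, $b\in\mathbb{R}$ and a compact set $\mathrm{K}\subset\mathrm{M}$ (depending on $a$) such that $$\mathcal{L}W_a\le -c\,W_a+b\,\mathbf{1}_{\mathrm{K}}\qquad\text{on }\mathrm{M}.$$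
   Context: For an ensemble $\mathbf{X}\in\mathbb{R}^{N\times d}$ with rows $\mathbf{x}_1,\dots,\mathbf{x}_N\in\mathbb{R}^d$, set $\bar{\mathbf{x}}=\frac1N\sum_i\mathbf{x}_i$ and $C=C(\mathbf{X})=\frac1N\sum_{i}(\mathbf{x}_i-\bar{\mathbf{x}})(\mathbf{x}_i-\bar{\mathbf{x}})^\top$. The state space is the open set $\mathrm{M}=\{\mathbf{X}\in\mathbb{R}^{N\times d}:\det C(\mathbf{X})>0\}$; compactness of $\mathrm{K}\subset \mathrm{M}$ is with respect to the usual topology. The affine invariant ensemble Langevin dynamics are $$d\mathbf{x}_i=\Big[-C(\mathbf{X})\nabla f(\mathbf{x}_i)+\frac{d+1}{N}(\mathbf{x}_i-\bar{\mathbf{x}})\Big]dt+\sqrt{2C(\mathbf{X})}\,dW_i,\quad i=1,\dots,N,$$ with independent $d$-dimensional Wiener processes $W_i$. Their generator, acting on $C^2$ functions $V:\mathrm{M}\to\mathbb{R}$, is $$\mathcal{L}V(\mathbf{X})=\sum_i\Big(-C\nabla f(\mathbf{x}_i)+\frac{d+1}{N}(\mathbf{x}_i-\bar{\mathbf{x}})\Big)\cdot\nabla_iV+\sum_i C:\nabla_i^2V,$$ where $\nabla_i,\nabla_i^2$ are the gradient and Hessian with respect to $\mathbf{x}_i$ and $A:B=\mathrm{Tr}(A^\top B)$. $\|\cdot\|$ on matrices is the operator norm, and $\succeq$ is the Loewner order. *)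

theory Defs
  imports "HOL-Analysis.Analysis"
begin

definition gradient :: "('a::real_inner \<Rightarrow> real) \<Rightarrow> 'a \<Rightarrow> 'a" where
  "gradient f x = (THE D. GDERIV f x :> D)"

lemma gradient_eqI: "GDERIV f x :> D \<Longrightarrow> gradient f x = D"
  unfolding gradient_def
proof (rule the_equality, assumption)
  fix D'
  assume "GDERIV f x :> D" and "GDERIV f x :> D'"
  then have "(\<lambda>h. inner h D') = (\<lambda>h. inner h D)"
    unfolding gderiv_def by (rule has_derivative_unique[rotated])
  then have "inner h D' = inner h D" for h
    by metis
  then have "inner (D' - D) (D' - D) = 0"
    by (simp add: inner_diff_right)
  then show "D' = D"
    by simp
qed

definition hessian :: "(real^'d \<Rightarrow> real) \<Rightarrow> real^'d \<Rightarrow> real^'d^'d" where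
  "hessian f x = jacobian (gradient f) (at x)"

definition C2 :: "(real^'d \<Rightarrow> real) \<Rightarrow> bool" where
  "C2 f \<longleftrightarrow> f differentiable_on UNIV \<and> gradient f differentiable_on UNIV \<and>
          continuous_on UNIV (hessian f)"

definition op_norm :: "real^'d^'d \<Rightarrow> real" where
  "op_norm A = onorm (\<lambda>v. A *v v)"

definition loewner_ge :: "real^'d^'d \<Rightarrow> real^'d^'d \<Rightarrow> bool"  (infix "\<succeq>" 50) where
  "A \<succeq> B \<longleftrightarrow> transpose (A - B) = A - B \<and> (\<forall>v. 0 \<le> v \<bullet> ((A - B) *v v))"

definition frobenius :: "real^'d^'d \<Rightarrow> real^'d^'d \<Rightarrow> real"  (infixl ":\<^sub>F" 70) where
  "A :\<^sub>F B = trace (transpose A ** B)"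

definition outer :: "real^'d \<Rightarrow> real^'d \<Rightarrow> real^'d^'d" where
  "outer u v = (\<chi> k l. u $ k * v $ l)"

text \<open>An ensemble of \<open>CARD('n)\<close> particles in dimension \<open>CARD('d)\<close> is an element \<open>X\<close> of
  \<open>real^'d^'n\<close>, whose row \<open>X $ i\<close> is the \<open>i\<close>-th particle.\<close>

definition ens_mean :: "real^'d^'n \<Rightarrow> real^'d" where
  "ens_mean X = (1 / real CARD('n)) *\<^sub>R (\<Sum>i\<in>UNIV. X $ i)"

definition ens_cov :: "real^'d^'n \<Rightarrow> real^'d^'d" where
  "ens_cov X = (1 / real CARD('n)) *\<^sub>R
     (\<Sum>i\<in>UNIV. outer (X $ i - ens_mean X) (X $ i - ens_mean X))"

definition state_space :: "(real^'d^'n) set" where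
  "state_space = {X. det (ens_cov X) > 0}"

definition set_row :: "real^'d^'n \<Rightarrow> 'n \<Rightarrow> real^'d \<Rightarrow> real^'d^'n" where
  "set_row X i y = (\<chi> j. if j = i then y else X $ j)"

definition row_gradient :: "'n \<Rightarrow> (real^'d^'n \<Rightarrow> real) \<Rightarrow> real^'d^'n \<Rightarrow> real^'d" where
  "row_gradient i V X = gradient (\<lambda>y. V (set_row X i y)) (X $ i)"

definition row_hessian :: "'n \<Rightarrow> (real^'d^'n \<Rightarrow> real) \<Rightarrow> real^'d^'n \<Rightarrow> real^'d^'d" where
  "row_hessian i V X = hessian (\<lambda>y. V (set_row X i y)) (X $ i)"

definition drift :: "(real^'d \<Rightarrow> real) \<Rightarrow> real^'d^'n \<Rightarrow> 'n \<Rightarrow> real^'d" where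
  "drift f X i = - (ens_cov X *v gradient f (X $ i))
     + (real (CARD('d) + 1) / real CARD('n)) *\<^sub>R (X $ i - ens_mean X)"

text \<open>The function \<open>V\<close> is total, but as \<open>state_space\<close> is open, the value of the generator at a
  point of \<open>state_space\<close> depends only on the restriction of \<open>V\<close> to \<open>state_space\<close>.\<close>

definition generator ::
  "(real^'d \<Rightarrow> real) \<Rightarrow> (real^'d^'n \<Rightarrow> real) \<Rightarrow> real^'d^'n \<Rightarrow> real" where
  "generator f V X = (\<Sum>i\<in>UNIV. drift f X i \<bullet> row_gradient i V X)
     + (\<Sum>i\<in>UNIV. ens_cov X :\<^sub>F row_hessian i V X)"

definition lyapunov :: "(real^'d \<Rightarrow> real) \<Rightarrow> real \<Rightarrow> real^'d^'n \<Rightarrow> real" where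
  "lyapunov f a X = exp (a / real CARD('n) * (\<Sum>i\<in>UNIV. f (X $ i)))
     * trace (matrix_inv (ens_cov X))"

end

theory Submission
  imports Defs
begin

text \<open>
  Write \<open>C\<close> for the covariance, \<open>P = C\<^sup>-\<^sup>1\<close>, \<open>y\<^sub>i\<close> for the deviation of particle \<open>i\<close> from the mean, \<open>g\<^sub>i\<close> for the
  gradient of \<open>f\<close> at particle \<open>i\<close>, \<open>T = Tr P\<close>, \<open>s = Tr C\<close>, and abbreviate averages over particles by \<open>avg\<close>.

  The affine invariant noise and the correction drift together repel the ensemble from degeneracy: without forces, the generator maps
  \<open>T\<close> to \<open>- \<kappa> T\<close> with \<open>\<kappa> = 2 (N - d - 2) / N\<close>, which is positive because \<open>N \<ge> d + 3\<close>. The force spoils this by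
  the cross term \<open>Q = avg (g\<^sub>i \<bullet> P y\<^sub>i)\<close>, which the Lipschitz bound on the gradient controls only by
  \<open>L sqrt (s T)\<close>. It is harmless where \<open>T\<close> is large compared with \<open>s\<close>, but not for widely
  spread ensembles. This is what the exponential factor is for: it contributes
  \<open>- a T G\<close> with the dissipation \<open>G = avg (g\<^sub>i \<bullet> C g\<^sub>i)\<close>.

  The decisive estimate is that \<open>G\<close> is quadratic in \<open>s\<close>. The potential has a uniformly convex tail, so
  \<open>avg (g\<^sub>i \<bullet> y\<^sub>i) \<ge> m s - c\<close> (\<open>gradient_monotone_up_to_constant\<close>), and as \<open>avg (y\<^sub>i \<bullet> P y\<^sub>i) = d\<close>, the
  Cauchy--Schwarz inequality for \<open>C\<close> gives \<open>G \<ge> (avg (g\<^sub>i \<bullet> y\<^sub>i))\<^sup>2 / d\<close>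
  (\<open>avg_force_quadratic_lower_bound\<close>). All other terms produced by the exponential are linear in \<open>s\<close>
  with a factor \<open>a\<close>; together with the quadratic term they cost at most a constant of order \<open>a\<close>, which
  a small \<open>a\<close> keeps below a fraction of \<open>\<kappa>\<close> (\<open>relative_generator_bound\<close>).

  There remains the cross term, to be compared with \<open>T (a s\<^sup>2 + a G + \<kappa>)\<close> up to constants. Since \<open>s T \<ge> d\<^sup>2 \<ge> 1\<close>, it is at
  most of order \<open>s T\<close>, so it is dominated when \<open>s\<close> is large, and also when \<open>T\<close> is large. When both are bounded but the
  ensemble is far from the origin, \<open>G\<close> is large: \<open>C\<close> is bounded below by \<open>1 / T\<close>, and the
  gradient grows linearly (\<open>avg_force_coercive\<close>, \<open>cross_term_bounds\<close>). What is left is the set of bounded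
  ensembles with bounded \<open>T\<close>, which is compact in the state space (\<open>compact_bounded_precision\<close>).

  All of this rests on the exact formula for the generator (\<open>generator_lyapunov\<close>), obtained from the derivative of
  the matrix inverse. No spectral decomposition is used: positivity of \<open>C\<close> and \<open>P\<close> comes from their
  representation as second moments.\<close>

section \<open>Rank-one matrices and traces\<close>

lemma outer_mult_vec [simp]: "outer u v *v w = (v \<bullet> w) *\<^sub>R u"
  by (simp add: vec_eq_iff outer_def matrix_vector_mult_def inner_vec_def sum_distrib_left
      mult_ac)

lemma trace_outer [simp]: "trace (outer u v) = u \<bullet> v"
  by (simp add: trace_def outer_def inner_vec_def)

lemma transpose_outer [simp]: "transpose (outer u v) = outer v u"
  by (simp add: vec_eq_iff outer_def transpose_def mult.commute)

lemma matrix_mult_outer: "A ** outer u v = outer (A *v u) v"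
  by (simp add: matrix_eq matrix_vector_mul_assoc[symmetric] matrix_vector_mult_scaleR)

lemma norm_outer: "norm (outer u v) = norm u * norm v"
proof -
  have "(norm (outer u v))\<^sup>2 = (\<Sum>k\<in>UNIV. (u $ k)\<^sup>2) * (\<Sum>k\<in>UNIV. (v $ k)\<^sup>2)"
    unfolding power2_norm_eq_inner inner_vec_def outer_def sum_product
    by (simp add: power2_eq_square mult_ac)
  also have "\<dots> = (norm u * norm v)\<^sup>2"
    unfolding power_mult_distrib power2_norm_eq_inner inner_vec_def
    by (simp add: power2_eq_square)
  finally show ?thesis
    by (rule power2_eq_imp_eq) auto
qed

lemma bounded_bilinear_outer: "bounded_bilinear (outer :: real^'d \<Rightarrow> real^'d \<Rightarrow> real^'d^'d)"
  by (rule bounded_bilinear.intro)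
    (auto simp: norm_outer vec_eq_iff intro!: exI[of _ 1], auto simp: outer_def algebra_simps)

lemma bounded_bilinear_matrix_mult: "bounded_bilinear ((**) :: real^'d^'d \<Rightarrow> real^'d^'d \<Rightarrow> real^'d^'d)"
  unfolding bilinear_conv_bounded_bilinear[symmetric] bilinear_def
  by (auto intro!: linearI simp: matrix_eq matrix_vector_mul_assoc[symmetric] algebra_simps
      scaleR_matrix_vector_assoc[symmetric])

lemma bounded_bilinear_matrix_vector_mult:
  "bounded_bilinear ((*v) :: real^'d^'d \<Rightarrow> real^'d \<Rightarrow> real^'d)"
  unfolding bilinear_conv_bounded_bilinear[symmetric] bilinear_def
  by (auto intro!: linearI simp: algebra_simps scaleR_matrix_vector_assoc[symmetric])

lemmas has_derivative_outer [derivative_intros] = bounded_bilinear.FDERIV[OF bounded_bilinear_outer]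
lemmas has_derivative_matrix_vector_mult [derivative_intros] =
  bounded_bilinear.FDERIV[OF bounded_bilinear_matrix_vector_mult]

lemmas continuous_on_outer [continuous_intros] =
  bounded_bilinear.continuous_on[OF bounded_bilinear_outer]
lemmas continuous_on_matrix_mult [continuous_intros] =
  bounded_bilinear.continuous_on[OF bounded_bilinear_matrix_mult]

lemma bounded_linear_trace: "bounded_linear (trace :: real^'d^'d \<Rightarrow> real)"
  unfolding linear_conv_bounded_linear[symmetric]
  by (rule linearI) (simp_all add: trace_def sum.distrib sum_distrib_left)

lemmas has_derivative_trace [derivative_intros] =
  bounded_linear.has_derivative[OF bounded_linear_trace]
lemmas continuous_on_trace [continuous_intros] =
  bounded_linear.continuous_on[OF bounded_linear_trace]

lemma continuous_on_det [continuous_intros]: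
  fixes A :: "'a::topological_space \<Rightarrow> real^'d^'d"
  assumes "continuous_on S A"
  shows "continuous_on S (\<lambda>x. det (A x))"
  unfolding det_def by (intro continuous_intros assms)

lemma trace_scaleR: "trace (c *\<^sub>R A) = c * trace A" for A :: "real^'d^'d"
  by (simp add: trace_def sum_distrib_left)

lemma trace_minus: "trace (- A) = - trace A" for A :: "real^'d^'d"
  by (simp add: trace_def sum_negf)

lemma minus_matrix_vector_mult: "(- A) *v v = - (A *v v)" for A :: "real^'d^'d"
  by (rule bounded_bilinear.minus_left[OF bounded_bilinear_matrix_vector_mult])

lemma matrix_vector_mult_minus: "A *v (- v) = - (A *v v)" for A :: "real^'d^'d"
  by (rule bounded_bilinear.minus_right[OF bounded_bilinear_matrix_vector_mult])

lemma trace_sum: "trace (\<Sum>i\<in>I. A i) = (\<Sum>i\<in>I. trace (A i))" for A :: "'i \<Rightarrow> real^'d^'d"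
  by (rule linear_sum[OF bounded_linear.linear[OF bounded_linear_trace]])

lemma matrix_mult_sum_right: "A ** (\<Sum>i\<in>I. B i) = (\<Sum>i\<in>I. A ** B i)"
  for A :: "real^'d^'d" and B :: "'i \<Rightarrow> real^'d^'d"
  by (rule bounded_bilinear.sum_right[OF bounded_bilinear_matrix_mult])

lemma sum_matrix_vector_mult: "(\<Sum>i\<in>I. B i) *v v = (\<Sum>i\<in>I. B i *v v)"
  for B :: "'i \<Rightarrow> real^'d^'d"
  by (rule bounded_bilinear.sum_left[OF bounded_bilinear_matrix_vector_mult])

lemma symmetric_inner_commute:
  fixes A :: "real^'d^'d"
  assumes "transpose A = A"
  shows "(A *v u) \<bullet> v = u \<bullet> (A *v v)"
  by (metis assms dot_lmul_matrix transpose_matrix_vector)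

section \<open>The matrix inverse\<close>

lemma matrix_inv_inverse:
  fixes A :: "real^'d^'d"
  assumes "det A \<noteq> 0"
  shows "A ** matrix_inv A = mat 1" "matrix_inv A ** A = mat 1"
proof -
  have "\<exists>B. A ** B = mat 1 \<and> B ** A = mat 1"
    using assms by (simp add: invertible_det_nz[symmetric] invertible_def)
  then have "A ** matrix_inv A = mat 1 \<and> matrix_inv A ** A = mat 1"
    unfolding matrix_inv_def by (rule someI_ex)
  then show "A ** matrix_inv A = mat 1" "matrix_inv A ** A = mat 1" by auto
qed

lemma norm_matrix_mult_le: "norm (A ** B) \<le> norm A * norm B" for A B :: "real^'d^'d"
proof -
  have "(norm (A ** B))\<^sup>2 = (\<Sum>i\<in>UNIV. \<Sum>j\<in>UNIV. (row i A \<bullet> column j B)\<^sup>2)"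
    unfolding power2_norm_eq_inner inner_vec_def
    by (simp add: matrix_matrix_mult_def row_def column_def power2_eq_square inner_vec_def)
  also have "\<dots> \<le> (\<Sum>i\<in>UNIV. \<Sum>j\<in>UNIV. (norm (row i A))\<^sup>2 * (norm (column j B))\<^sup>2)"
    by (intro sum_mono) (metis Cauchy_Schwarz_ineq power2_norm_eq_inner)
  also have "\<dots> = (\<Sum>i\<in>UNIV. (norm (row i A))\<^sup>2) * (\<Sum>j\<in>UNIV. (norm (column j B))\<^sup>2)"
    by (simp add: sum_product)
  also have "(\<Sum>i\<in>UNIV. (norm (row i A))\<^sup>2) = (norm A)\<^sup>2"
    unfolding power2_norm_eq_inner by (simp add: inner_vec_def row_def)
  also have "(\<Sum>j\<in>UNIV. (norm (column j B))\<^sup>2) = (norm B)\<^sup>2"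
    unfolding power2_norm_eq_inner inner_vec_def column_def
    by (simp, rule sum.swap)
  finally have "(norm (A ** B))\<^sup>2 \<le> (norm A * norm B)\<^sup>2"
    by (simp add: power_mult_distrib)
  then show ?thesis
    by (rule power2_le_imp_le) auto
qed

lemma matrix_inv_diff:
  fixes A B :: "real^'d^'d"
  assumes "det A \<noteq> 0" "det B \<noteq> 0"
  shows "matrix_inv B - matrix_inv A = - (matrix_inv B ** (B - A) ** matrix_inv A)"
proof -
  have "matrix_inv B ** (B - A) ** matrix_inv A
      = (matrix_inv B ** B) ** matrix_inv A - matrix_inv B ** (A ** matrix_inv A)"
    by (simp add: matrix_eq matrix_vector_mul_assoc[symmetric] algebra_simps)
  then show ?thesis
    by (simp add: matrix_inv_inverse assms)
qed

lemma eventually_det_nonzero: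
  fixes A :: "real^'d^'d"
  assumes "det A \<noteq> 0"
  shows "\<forall>\<^sub>F B in at A. det B \<noteq> 0"
proof -
  have "continuous_on UNIV (det :: real^'d^'d \<Rightarrow> real)"
    by (intro continuous_intros)
  then have "isCont (det :: real^'d^'d \<Rightarrow> real) A"
    by (simp add: continuous_on_eq_continuous_at)
  then show ?thesis
    unfolding isCont_def by (rule tendsto_imp_eventually_ne) (rule assms)
qed

text \<open>
  From \<open>B\<^sup>-\<^sup>1 - A\<^sup>-\<^sup>1 = - B\<^sup>-\<^sup>1 (B - A) A\<^sup>-\<^sup>1\<close>, the norm of \<open>B\<^sup>-\<^sup>1\<close> is at most twice that of \<open>A\<^sup>-\<^sup>1\<close>
  once \<open>norm (B - A) * norm (A\<^sup>-\<^sup>1) < 1/2\<close>; inserting this bound into the same identity shows that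
  \<open>B\<^sup>-\<^sup>1\<close> is close to \<open>A\<^sup>-\<^sup>1\<close>.\<close>

lemma isCont_matrix_inv:
  fixes A :: "real^'d^'d"
  assumes "det A \<noteq> 0"
  shows "isCont matrix_inv A"
proof -
  define p where "p = norm (matrix_inv A)"
  have p: "p \<ge> 0" by (simp add: p_def)
  have "\<forall>\<^sub>F B in at A. det B \<noteq> 0"
    by (rule eventually_det_nonzero[OF assms])
  moreover have "\<forall>\<^sub>F B in at A. norm (B - A) * p < 1/2"
  proof -
    have "((\<lambda>B. norm (B - A) * p) \<longlongrightarrow> norm (A - A) * p) (at A)"
      by (intro tendsto_intros)
    then show ?thesis by (intro order_tendstoD) auto
  qed
  ultimately have "\<forall>\<^sub>F B in at A. norm (matrix_inv B - matrix_inv A) \<le> 2 * p * norm (B - A) * p"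
  proof eventually_elim
    case (elim B)
    define q where "q = norm (matrix_inv B)"
    have *: "norm (matrix_inv B - matrix_inv A) \<le> q * norm (B - A) * p"
      unfolding matrix_inv_diff[OF assms elim(1)] norm_minus_cancel p_def q_def
      by (intro order.trans[OF norm_matrix_mult_le] mult_right_mono norm_matrix_mult_le) auto
    have "q \<le> p + norm (matrix_inv B - matrix_inv A)"
      unfolding p_def q_def using norm_triangle_ineq2[of "matrix_inv B" "matrix_inv A"] by linarith
    also have "\<dots> \<le> p + q * (norm (B - A) * p)"
      using * by (simp add: mult_ac)
    also have "\<dots> \<le> p + q * (1/2)"
      using elim(2) by (intro add_left_mono mult_left_mono) (auto simp: q_def)
    finally have "q \<le> 2 * p" by simp
    then have "q * norm (B - A) * p \<le> 2 * p * norm (B - A) * p"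
      by (intro mult_right_mono) (auto simp: p)
    with * show ?case by linarith
  qed
  moreover have "((\<lambda>B. 2 * p * norm (B - A) * p) \<longlongrightarrow> 2 * p * norm (A - A) * p) (at A)"
    by (intro tendsto_intros)
  then have "((\<lambda>B. 2 * p * norm (B - A) * p) \<longlongrightarrow> 0) (at A)"
    by simp
  ultimately have "((\<lambda>B. matrix_inv B - matrix_inv A) \<longlongrightarrow> 0) (at A)"
    by (rule Lim_null_comparison)
  then show ?thesis
    by (simp add: isCont_def LIM_zero_iff)
qed

text \<open>
  By the same identity, the remainder of the linear approximation is
  \<open>(A\<^sup>-\<^sup>1 - B\<^sup>-\<^sup>1) (B - A) A\<^sup>-\<^sup>1\<close>, so continuity of the inverse suffices.\<close>

lemma has_derivative_matrix_inv:
  fixes A :: "real^'d^'d"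
  assumes "det A \<noteq> 0"
  shows "(matrix_inv has_derivative (\<lambda>H. - (matrix_inv A ** H ** matrix_inv A))) (at A)"
proof -
  let ?P = "matrix_inv A"
  let ?D = "\<lambda>H. - (?P ** H ** ?P)"
  have "bounded_linear ?D"
    by (intro bounded_linear_minus bounded_bilinear.bounded_linear_left[OF
          bounded_bilinear_matrix_mult, THEN bounded_linear_compose]
        bounded_bilinear.bounded_linear_right[OF bounded_bilinear_matrix_mult])
  moreover have "((\<lambda>B. norm (matrix_inv B - ?P - ?D (B - A)) / norm (B - A)) \<longlongrightarrow> 0) (at A)"
  proof (rule Lim_null_comparison)
    have "((\<lambda>B. norm (?P - matrix_inv B) * norm ?P) \<longlongrightarrow> norm (?P - ?P) * norm ?P) (at A)"
      by (intro tendsto_intros isCont_matrix_inv[OF assms, unfolded isCont_def])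
    then show "((\<lambda>B. norm (?P - matrix_inv B) * norm ?P) \<longlongrightarrow> 0) (at A)"
      by simp
    show "\<forall>\<^sub>F B in at A. norm (norm (matrix_inv B - ?P - ?D (B - A)) / norm (B - A))
        \<le> norm (?P - matrix_inv B) * norm ?P"
      using eventually_det_nonzero[OF assms] eventually_neq_at_within[of A A UNIV]
    proof eventually_elim
      case (elim B)
      have "matrix_inv B - ?P - ?D (B - A) = (?P - matrix_inv B) ** (B - A) ** ?P"
        unfolding matrix_inv_diff[OF assms elim(1)]
        by (simp add: matrix_eq matrix_vector_mul_assoc[symmetric] algebra_simps)
      then have "norm (matrix_inv B - ?P - ?D (B - A))
          \<le> norm (?P - matrix_inv B) * norm (B - A) * norm ?P"
        by (metis (no_types, lifting) norm_matrix_mult_le order.trans mult_right_mono norm_ge_zero)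
      then show ?case
        using elim(2) by (simp add: divide_le_eq mult_ac)
    qed
  qed
  ultimately show ?thesis
    by (simp add: has_derivative_iff_norm)
qed

section \<open>Ensemble moments\<close>

definition avg :: "('n::finite \<Rightarrow> real) \<Rightarrow> real" where
  "avg F = (\<Sum>i\<in>UNIV. F i) / real CARD('n)"

definition dev :: "real^'d^'n \<Rightarrow> 'n \<Rightarrow> real^'d" where
  "dev X i = X $ i - ens_mean X"

definition precision :: "real^'d^'n \<Rightarrow> real^'d^'d" where
  "precision X = matrix_inv (ens_cov X)"

text \<open>
  The dual deviation \<open>C\<^sup>-\<^sup>1 (x\<^sub>i - mean)\<close>. The gradient of \<open>Tr C\<^sup>-\<^sup>1\<close> in particle \<open>i\<close> is \<open>- 2/N C\<^sup>-\<^sup>1\<close>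
  applied to it, and \<open>C\<^sup>-\<^sup>1\<close> is the second moment of these
  directions just as \<open>C\<close> is that of the deviations.\<close>

definition pdev :: "real^'d^'n \<Rightarrow> 'n \<Rightarrow> real^'d" where
  "pdev X i = precision X *v dev X i"

lemma sum_eq_avg: "(\<Sum>i\<in>UNIV. F i) = real CARD('n) * avg F" for F :: "'n::finite \<Rightarrow> real"
  by (simp add: avg_def)

lemma avg_const [simp]: "avg (\<lambda>i::'n::finite. c) = c"
  by (simp add: avg_def)

lemma avg_add: "avg (\<lambda>i. F i + G i) = avg F + avg G"
  by (simp add: avg_def sum.distrib add_divide_distrib)

lemma avg_diff: "avg (\<lambda>i. F i - G i) = avg F - avg G"
  by (simp add: avg_def sum_subtractf diff_divide_distrib)

lemma avg_cmult: "avg (\<lambda>i. c * F i) = c * avg F"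
  by (simp add: avg_def sum_distrib_left)

lemma avg_mono: "(\<And>i. F i \<le> G i) \<Longrightarrow> avg F \<le> avg G"
  by (auto simp: avg_def intro!: divide_right_mono sum_mono)

lemma avg_nonneg: "(\<And>i. 0 \<le> F i) \<Longrightarrow> 0 \<le> avg F"
  by (auto simp: avg_def intro!: divide_nonneg_nonneg sum_nonneg)

lemma sum_dev: "(\<Sum>i\<in>UNIV. dev X i) = 0"
  by (simp add: dev_def sum_subtractf ens_mean_def sum_constant_scaleR del: sum_constant)

lemma avg_inner_dev: "avg (\<lambda>i. v \<bullet> dev X i) = 0"
  by (simp add: avg_def inner_sum_right[symmetric] sum_dev)

lemma ens_cov_eq: "ens_cov X = (1 / real CARD('n)) *\<^sub>R (\<Sum>i\<in>UNIV. outer (dev X i) (dev X i))"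
  for X :: "real^'d^'n"
  by (simp add: ens_cov_def dev_def)

lemma transpose_sum: "transpose (\<Sum>i\<in>I. A i) = (\<Sum>i\<in>I. transpose (A i))"
  by (simp add: vec_eq_iff transpose_def)

lemma transpose_ens_cov [simp]: "transpose (ens_cov X) = ens_cov X"
  by (simp add: ens_cov_eq transpose_scalar transpose_sum)

lemma inner_ens_cov: "u \<bullet> (ens_cov X *v v) = avg (\<lambda>i. (dev X i \<bullet> u) * (dev X i \<bullet> v))"
  by (simp add: ens_cov_eq scaleR_matrix_vector_assoc[symmetric] sum_matrix_vector_mult avg_def
      inner_sum_right inner_commute mult.commute)

text \<open>
  Contracting a matrix with \<open>C\<close> amounts to averaging its quadratic form over the deviations. All
  second-order terms of the generator are computed in this way.\<close>

lemma frobenius_ens_cov: "ens_cov X :\<^sub>F M = avg (\<lambda>i. dev X i \<bullet> (M *v dev X i))"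
  for X :: "real^'d^'n"
proof -
  have "ens_cov X :\<^sub>F M = trace (M ** ens_cov X)"
    unfolding frobenius_def by (subst trace_mul_sym) simp
  also have "\<dots> = avg (\<lambda>i. dev X i \<bullet> (M *v dev X i))"
    unfolding ens_cov_eq bounded_bilinear.scaleR_right[OF bounded_bilinear_matrix_mult]
      matrix_mult_sum_right trace_scaleR trace_sum matrix_mult_outer trace_outer
    by (simp add: avg_def inner_commute)
  finally show ?thesis .
qed

context
  fixes X :: "real^'d^'n"
  assumes X: "X \<in> state_space"
begin

lemma ens_cov_precision:
  "ens_cov X ** precision X = mat 1" "precision X ** ens_cov X = mat 1"
  using X by (auto simp: state_space_def precision_def matrix_inv_inverse)

lemma ens_cov_precision_vec [simp]:
  "ens_cov X *v (precision X *v v) = v" "precision X *v (ens_cov X *v v) = v"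
  by (simp_all add: matrix_vector_mul_assoc ens_cov_precision)

lemma ens_cov_pdev [simp]: "ens_cov X *v pdev X i = dev X i"
  by (simp add: pdev_def)

lemma transpose_precision [simp]: "transpose (precision X) = precision X"
proof -
  have "transpose (precision X) ** ens_cov X = mat 1"
    by (metis ens_cov_precision(1) matrix_transpose_mul transpose_ens_cov transpose_mat)
  then have "transpose (precision X) ** (ens_cov X ** precision X) = precision X"
    by (simp add: matrix_mul_assoc)
  then show ?thesis
    by (simp add: ens_cov_precision)
qed

text \<open>
  This is \<open>P = P C P\<close>, with \<open>C\<close> written as the second moment of the deviations. It replaces
  spectral arguments: positivity and norm bounds for \<open>P\<close> can be read off the Gram form.\<close>

lemma precision_eq:
  "precision X = (1 / real CARD('n)) *\<^sub>R (\<Sum>i\<in>UNIV. outer (pdev X i) (pdev X i))"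
proof -
  have "precision X *v v = ((1 / real CARD('n)) *\<^sub>R (\<Sum>i\<in>UNIV. outer (pdev X i) (pdev X i))) *v v" for v
  proof -
    have "precision X *v v = precision X *v (ens_cov X *v (precision X *v v))"
      by simp
    also have "ens_cov X *v (precision X *v v)
        = (1 / real CARD('n)) *\<^sub>R (\<Sum>i\<in>UNIV. (pdev X i \<bullet> v) *\<^sub>R dev X i)"
      unfolding ens_cov_eq
      by (simp add: scaleR_matrix_vector_assoc[symmetric] sum_matrix_vector_mult pdev_def
          symmetric_inner_commute)
    finally show ?thesis
      by (simp add: scaleR_matrix_vector_assoc[symmetric] sum_matrix_vector_mult pdev_def
          matrix_vector_mult_scaleR linear_sum[OF matrix_vector_mul_linear])
  qed
  then show ?thesis by (simp add: matrix_eq)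
qed

lemma trace_precision: "trace (precision X) = avg (\<lambda>i. pdev X i \<bullet> pdev X i)"
  by (subst precision_eq) (simp add: trace_scaleR trace_sum avg_def)

lemma avg_dev_pdev: "avg (\<lambda>i. dev X i \<bullet> pdev X i) = real CARD('d)"
proof -
  have "avg (\<lambda>i. dev X i \<bullet> pdev X i) = ens_cov X :\<^sub>F precision X"
    by (simp add: frobenius_ens_cov pdev_def)
  also have "\<dots> = real CARD('d)"
    by (simp add: frobenius_def ens_cov_precision trace_I)
  finally show ?thesis .
qed

lemma inner_precision: "u \<bullet> (precision X *v v) = avg (\<lambda>i. (pdev X i \<bullet> u) * (pdev X i \<bullet> v))"
  by (subst precision_eq)
    (simp add: scaleR_matrix_vector_assoc[symmetric] sum_matrix_vector_mult avg_def
      inner_sum_right inner_commute mult.commute)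

lemma norm_precision_le_trace: "norm (precision X) \<le> trace (precision X)"
proof -
  have "norm (\<Sum>i\<in>UNIV. outer (pdev X i) (pdev X i)) \<le> (\<Sum>i\<in>UNIV. pdev X i \<bullet> pdev X i)"
    by (rule order.trans[OF norm_sum])
      (simp add: norm_outer power2_norm_eq_inner[symmetric] power2_eq_square)
  then show ?thesis
    unfolding trace_precision avg_def by (subst precision_eq) (simp add: divide_right_mono)
qed

lemma trace_precision_pos: "0 < trace (precision X)"
proof (rule ccontr)
  assume "\<not> 0 < trace (precision X)"
  then have "precision X = 0"
    using norm_precision_le_trace by (metis norm_le_zero_iff not_less order.trans)
  then have "avg (\<lambda>i. dev X i \<bullet> pdev X i) = 0"
    by (simp add: pdev_def)
  then show False
    by (simp add: avg_dev_pdev)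
qed

text \<open>
  The smallest eigenvalue of \<open>C\<close> is at least \<open>1 / Tr C\<^sup>-\<^sup>1\<close>. Instead of diagonalising, evaluate the
  positive semidefinite form \<open>C\<close> at \<open>T v - P v\<close>, where \<open>T = Tr P\<close>.\<close>

lemma ens_cov_lower_bound: "v \<bullet> v \<le> trace (precision X) * (v \<bullet> (ens_cov X *v v))"
proof -
  let ?T = "trace (precision X)" and ?p = "precision X *v v"
  have "v \<bullet> ?p \<le> ?T * (v \<bullet> v)"
  proof -
    have "v \<bullet> ?p = avg (\<lambda>i. (pdev X i \<bullet> v)\<^sup>2)"
      by (simp add: inner_precision power2_eq_square)
    also have "\<dots> \<le> avg (\<lambda>i. (v \<bullet> v) * (pdev X i \<bullet> pdev X i))"
      by (intro avg_mono) (metis Cauchy_Schwarz_ineq mult.commute)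
    finally show ?thesis
      by (simp add: avg_cmult trace_precision mult.commute)
  qed
  moreover have "0 \<le> (?T *\<^sub>R v - ?p) \<bullet> (ens_cov X *v (?T *\<^sub>R v - ?p))"
    by (simp add: inner_ens_cov avg_nonneg)
  moreover have "(?T *\<^sub>R v - ?p) \<bullet> (ens_cov X *v (?T *\<^sub>R v - ?p))
      = ?T\<^sup>2 * (v \<bullet> (ens_cov X *v v)) - 2 * ?T * (v \<bullet> v) + v \<bullet> ?p"
  proof -
    have "?p \<bullet> (ens_cov X *v v) = v \<bullet> v"
      by (metis ens_cov_precision_vec(1) symmetric_inner_commute transpose_ens_cov)
    then show ?thesis
      by (simp add: algebra_simps inner_diff_left inner_diff_right power2_eq_square inner_commute)
  qed
  ultimately have "?T * (v \<bullet> v) \<le> ?T * (?T * (v \<bullet> (ens_cov X *v v)))"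
    by (simp add: power2_eq_square mult.assoc)
  then show ?thesis
    using trace_precision_pos by simp
qed

text \<open>
  Cauchy--Schwarz for the pairing of deviations with dual deviations, whose average is
  the dimension. In particular \<open>Tr C\<close> and \<open>Tr C\<^sup>-\<^sup>1\<close> cannot both be small.\<close>

lemma spread_trace_precision:
  "(real CARD('d))\<^sup>2 \<le> avg (\<lambda>i. dev X i \<bullet> dev X i) * trace (precision X)"
proof -
  let ?s = "avg (\<lambda>i. dev X i \<bullet> dev X i)" and ?T = "trace (precision X)"
  let ?d = "real CARD('d)"
  have "0 \<le> avg (\<lambda>i. (?T *\<^sub>R dev X i - ?d *\<^sub>R pdev X i) \<bullet> (?T *\<^sub>R dev X i - ?d *\<^sub>R pdev X i))"
    by (intro avg_nonneg inner_ge_zero)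
  also have "\<dots> = avg (\<lambda>i. ?T\<^sup>2 * (dev X i \<bullet> dev X i) + ?d\<^sup>2 * (pdev X i \<bullet> pdev X i)
      - (2 * ?T * ?d) * (dev X i \<bullet> pdev X i))"
    by (intro arg_cong[of _ _ avg] ext)
      (simp add: algebra_simps inner_diff_left inner_diff_right power2_eq_square inner_commute)
  also have "\<dots> = ?T * (?T * ?s - ?d\<^sup>2)"
    by (simp add: avg_diff avg_add avg_cmult avg_dev_pdev trace_precision[symmetric]
        power2_eq_square algebra_simps)
  finally show ?thesis
    using trace_precision_pos by (simp add: zero_le_mult_iff mult.commute)
qed

end

section \<open>Moving one particle\<close>

lemma set_row_nth: "set_row X i y $ j = (if j = i then y else X $ j)"
  by (simp add: set_row_def)

lemma set_row_self [simp]: "set_row X i (X $ i) = X"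
  by (simp add: vec_eq_iff set_row_nth)

lemma has_derivative_set_row:
  "((\<lambda>y. set_row X i y $ j) has_derivative (\<lambda>h. of_bool (j = i) *\<^sub>R h)) (at y)"
  by (auto simp: set_row_nth intro!: derivative_eq_intros)

lemma has_derivative_ens_mean_set_row:
  fixes X :: "real^'d^'n"
  shows "((\<lambda>y. ens_mean (set_row X i y)) has_derivative (\<lambda>h. (1 / real CARD('n)) *\<^sub>R h)) (at y)"
  unfolding ens_mean_def
  by (rule derivative_eq_intros has_derivative_set_row refl)+ (simp add: scaleR_left.sum[symmetric])

lemma has_derivative_dev_set_row:
  fixes X :: "real^'d^'n"
  shows "((\<lambda>y. dev (set_row X i y) j) has_derivative
    (\<lambda>h. of_bool (j = i) *\<^sub>R h - (1 / real CARD('n)) *\<^sub>R h)) (at y)"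
  unfolding dev_def
  by (intro has_derivative_diff has_derivative_set_row has_derivative_ens_mean_set_row)

text \<open>
  Moving particle \<open>i\<close> also moves the mean, and hence every deviation; this indirect effect cancels
  because the deviations sum to zero.\<close>

lemma has_derivative_ens_cov_set_row:
  fixes X :: "real^'d^'n" and i :: 'n
  defines "Z \<equiv> set_row X i"
  shows "((\<lambda>y. ens_cov (Z y)) has_derivative
    (\<lambda>h. (1 / real CARD('n)) *\<^sub>R (outer h (dev (Z y) i) + outer (dev (Z y) i) h))) (at y)"
proof -
  let ?N = "real CARD('n)"
  interpret outer: bounded_bilinear "outer :: real^'d \<Rightarrow> real^'d \<Rightarrow> real^'d^'d"
    by (rule bounded_bilinear_outer)
  have "((\<lambda>y. ens_cov (Z y)) has_derivative (\<lambda>h. (1 / ?N) *\<^sub>R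
     (\<Sum>j\<in>UNIV. outer (dev (Z y) j) (of_bool (j = i) *\<^sub>R h - (1 / ?N) *\<^sub>R h)
        + outer (of_bool (j = i) *\<^sub>R h - (1 / ?N) *\<^sub>R h) (dev (Z y) j)))) (at y)"
    unfolding ens_cov_eq Z_def
    by (intro has_derivative_scaleR_right has_derivative_sum has_derivative_outer
        has_derivative_dev_set_row)
  moreover have "(\<Sum>j\<in>UNIV. outer (dev (Z y) j) (of_bool (j = i) *\<^sub>R h - (1 / ?N) *\<^sub>R h)
        + outer (of_bool (j = i) *\<^sub>R h - (1 / ?N) *\<^sub>R h) (dev (Z y) j))
      = outer h (dev (Z y) i) + outer (dev (Z y) i) h" for h
  proof -
    have "(\<Sum>j\<in>UNIV. outer (dev (Z y) j) (of_bool (j = i) *\<^sub>R h)) = outer (dev (Z y) i) h"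
      by (subst sum.remove[of UNIV i]) (auto simp: outer.zero_right intro!: sum.neutral)
    moreover have "(\<Sum>j\<in>UNIV. outer (of_bool (j = i) *\<^sub>R h) (dev (Z y) j)) = outer h (dev (Z y) i)"
      by (subst sum.remove[of UNIV i]) (auto simp: outer.zero_left intro!: sum.neutral)
    moreover have "(\<Sum>j\<in>UNIV. outer (dev (Z y) j) ((1 / ?N) *\<^sub>R h)) = 0"
      by (simp only: outer.sum_left[symmetric] sum_dev outer.zero_left)
    moreover have "(\<Sum>j\<in>UNIV. outer ((1 / ?N) *\<^sub>R h) (dev (Z y) j)) = 0"
      by (simp only: outer.sum_right[symmetric] sum_dev outer.zero_right)
    ultimately show ?thesis
      by (simp only: outer.diff_left outer.diff_right sum.distrib sum_subtractf) simp
  qed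
  ultimately show ?thesis by simp
qed

lemma continuous_on_ens_cov: "continuous_on S (\<lambda>X. ens_cov X :: real^'d^'d)"
  unfolding ens_cov_def ens_mean_def by (intro continuous_intros)

lemma open_state_space: "open (state_space :: (real^'d^'n) set)"
proof -
  have "state_space = (\<lambda>X :: real^'d^'n. det (ens_cov X)) -` {0<..}"
    by (auto simp: state_space_def)
  moreover have "continuous_on UNIV (\<lambda>X :: real^'d^'n. det (ens_cov X))"
    by (intro continuous_intros continuous_on_ens_cov)
  ultimately show ?thesis
    by (metis open_vimage open_greaterThan)
qed

lemma open_row_slice: "open {y. set_row X i y \<in> state_space}"
proof -
  have "continuous_on UNIV (\<lambda>y. set_row X i y)"
    unfolding set_row_def
  proof (rule continuous_on_vec_lambda)
    show "continuous_on UNIV (\<lambda>y. if j = i then y else X $ j)" for j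
      by (cases "j = i") auto
  qed
  then have "open ((\<lambda>y. set_row X i y) -` state_space)"
    by (intro open_vimage open_state_space)
  then show ?thesis by (simp add: vimage_def)
qed

lemma has_derivative_precision_set_row:
  fixes X :: "real^'d^'n" and i :: 'n
  defines "Z \<equiv> set_row X i"
  assumes Z: "Z y \<in> state_space"
  shows "((\<lambda>y. precision (Z y)) has_derivative
    (\<lambda>h. - (1 / real CARD('n)) *\<^sub>R (outer (precision (Z y) *v h) (pdev (Z y) i)
       + outer (pdev (Z y) i) (precision (Z y) *v h)))) (at y)"
proof -
  let ?P = "precision (Z y)" and ?N = "real CARD('n)"
  interpret mult: bounded_bilinear "(**) :: real^'d^'d \<Rightarrow> real^'d^'d \<Rightarrow> real^'d^'d"
    by (rule bounded_bilinear_matrix_mult)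
  have nz: "det (ens_cov (Z y)) \<noteq> 0"
    using Z by (auto simp: state_space_def)
  have "((\<lambda>y. precision (Z y)) has_derivative
      (\<lambda>h. - (?P ** ((1 / ?N) *\<^sub>R (outer h (dev (Z y) i) + outer (dev (Z y) i) h)) ** ?P))) (at y)"
    unfolding precision_def
    by (rule has_derivative_compose[OF has_derivative_ens_cov_set_row[of X i y, folded Z_def]
          has_derivative_matrix_inv[OF nz]])
  moreover have "?P ** outer u v ** ?P = outer (?P *v u) (?P *v v)" for u v
    using transpose_precision[OF Z]
    by (simp add: matrix_eq matrix_vector_mul_assoc[symmetric] symmetric_inner_commute
        matrix_vector_mult_scaleR)
  ultimately show ?thesis
    by (simp add: mult.scaleR_right mult.scaleR_left mult.add_left mult.add_right pdev_def
        flip: scaleR_minus_left)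
qed

section \<open>The generator applied to the Lyapunov function\<close>

text \<open>
  A description operator defines \<^const>\<open>gradient\<close>, so the existence of a gradient vector has to be
  supplied, by representing the derivative as an inner product.\<close>

lemma GDERIV_gradient:
  fixes f :: "real^'d \<Rightarrow> real"
  assumes "C2 f"
  shows "GDERIV f x :> gradient f x"
proof -
  obtain D where D: "(f has_derivative D) (at x)"
    using assms by (auto simp: C2_def differentiable_on_def differentiable_def)
  interpret D: bounded_linear D
    using D by (rule has_derivative_bounded_linear)
  have "D h = h \<bullet> (\<Sum>b\<in>Basis. D b *\<^sub>R b)" for h
  proof -
    have "D h = D (\<Sum>b\<in>Basis. (h \<bullet> b) *\<^sub>R b)"
      by (simp add: euclidean_representation)
    then show ?thesis
      by (simp add: D.sum D.scaleR inner_sum_right mult.commute)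
  qed
  then have "D = (\<lambda>h. h \<bullet> (\<Sum>b\<in>Basis. D b *\<^sub>R b))"
    by (rule ext)
  with D have "GDERIV f x :> (\<Sum>b\<in>Basis. D b *\<^sub>R b)"
    unfolding gderiv_def by (rule has_derivative_eq_rhs)
  then show ?thesis
    using gradient_eqI by metis
qed

lemma has_derivative_gradient:
  fixes f :: "real^'d \<Rightarrow> real"
  assumes "C2 f"
  shows "(gradient f has_derivative (\<lambda>h. hessian f x *v h)) (at x)"
  using assms unfolding hessian_def
  by (auto simp: C2_def differentiable_on_def jacobian_works[symmetric])

text \<open>
  The closed form of the gradient in particle \<open>i\<close>. It is valid on the whole open slice of the state space,
  and can therefore be differentiated once more.\<close>

definition lyapunov_row_gradient ::
  "(real^'d \<Rightarrow> real) \<Rightarrow> real \<Rightarrow> 'n \<Rightarrow> real^'d^'n \<Rightarrow> real^'d" where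
  "lyapunov_row_gradient f a i Z = exp (a / real CARD('n) * (\<Sum>j\<in>UNIV. f (Z $ j))) *\<^sub>R
     ((a / real CARD('n) * trace (precision Z)) *\<^sub>R gradient f (Z $ i)
       - (2 / real CARD('n)) *\<^sub>R (precision Z *v pdev Z i))"

context
  fixes f :: "real^'d \<Rightarrow> real" and a :: real and X :: "real^'d^'n" and i :: 'n
    and Z N y
  defines "Z \<equiv> set_row X i" and "N \<equiv> real CARD('n)"
  assumes f: "C2 f" and Z: "Z y \<in> state_space"
begin

lemma has_derivative_exp_potential:
  "((\<lambda>y. exp (a / N * (\<Sum>j\<in>UNIV. f (Z y $ j)))) has_derivative
    (\<lambda>h. exp (a / N * (\<Sum>j\<in>UNIV. f (Z y $ j))) * (a / N * (h \<bullet> gradient f (Z y $ i))))) (at y)"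
proof -
  have "((\<lambda>y. f (Z y $ j)) has_derivative
      (\<lambda>h. (of_bool (j = i) *\<^sub>R h) \<bullet> gradient f (Z y $ j))) (at y)" for j
    unfolding Z_def
    by (rule has_derivative_compose[OF has_derivative_set_row
          GDERIV_gradient[OF f, unfolded gderiv_def]])
  then have "((\<lambda>y. \<Sum>j\<in>UNIV. f (Z y $ j)) has_derivative
      (\<lambda>h. \<Sum>j\<in>UNIV. (of_bool (j = i) *\<^sub>R h) \<bullet> gradient f (Z y $ j))) (at y)"
    by (intro has_derivative_sum)
  moreover have "(\<Sum>j\<in>UNIV. (of_bool (j = i) *\<^sub>R h) \<bullet> gradient f (Z y $ j)) = h \<bullet> gradient f (Z y $ i)"
    for h by (subst sum.remove[of UNIV i]) (auto intro!: sum.neutral)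
  ultimately have "((\<lambda>y. \<Sum>j\<in>UNIV. f (Z y $ j)) has_derivative (\<lambda>h. h \<bullet> gradient f (Z y $ i))) (at y)"
    by simp
  then have "((\<lambda>y. a / N * (\<Sum>j\<in>UNIV. f (Z y $ j))) has_derivative
      (\<lambda>h. a / N * (h \<bullet> gradient f (Z y $ i)))) (at y)"
    by (rule has_derivative_mult_right)
  from has_derivative_exp[OF this] show ?thesis
    by (simp only: mult.commute)
qed

lemma has_derivative_trace_precision:
  "((\<lambda>y. trace (precision (Z y))) has_derivative
    (\<lambda>h. - (2 / N) * (h \<bullet> (precision (Z y) *v pdev (Z y) i)))) (at y)"
proof -
  have "((\<lambda>y. trace (precision (Z y))) has_derivative
      (\<lambda>h. trace (- (1 / N) *\<^sub>R (outer (precision (Z y) *v h) (pdev (Z y) i)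
       + outer (pdev (Z y) i) (precision (Z y) *v h))))) (at y)"
    using Z unfolding Z_def N_def
    by (intro has_derivative_trace has_derivative_precision_set_row)
  moreover have "(precision (Z y) *v h) \<bullet> pdev (Z y) i = h \<bullet> (precision (Z y) *v pdev (Z y) i)" for h
    by (simp add: symmetric_inner_commute transpose_precision[OF Z])
  ultimately show ?thesis
    by (simp add: trace_scaleR trace_minus trace_add inner_commute[of "pdev (Z y) i"] N_def)
qed

lemma GDERIV_lyapunov:
  "GDERIV (\<lambda>y. lyapunov f a (Z y)) y :> lyapunov_row_gradient f a i (Z y)"
proof -
  let ?E = "exp (a / N * (\<Sum>j\<in>UNIV. f (Z y $ j)))"
  have "((\<lambda>y. lyapunov f a (Z y)) has_derivative
      (\<lambda>h. ?E * (- (2 / N) * (h \<bullet> (precision (Z y) *v pdev (Z y) i)))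
        + ?E * (a / N * (h \<bullet> gradient f (Z y $ i))) * trace (precision (Z y)))) (at y)"
    unfolding lyapunov_def precision_def[symmetric] N_def[symmetric]
    by (intro has_derivative_mult has_derivative_exp_potential has_derivative_trace_precision)
  then show ?thesis
    unfolding gderiv_def lyapunov_row_gradient_def N_def[symmetric]
    by (rule has_derivative_eq_rhs) (simp add: fun_eq_iff inner_diff_right algebra_simps)
qed

text \<open>
  The product rule for \<open>P (P y)\<close> with \<open>y\<close> the deviation of the moving particle: the bracket comes
  from differentiating the two factors \<open>P\<close>, the last term from \<open>y\<close>, whose derivative is \<open>1 - 1/N\<close>
  because the particle drags the mean along.\<close>

lemma has_derivative_precision_pdev:
  defines "P \<equiv> precision (Z y)" and "q \<equiv> pdev (Z y) i"
  shows "((\<lambda>y. precision (Z y) *v pdev (Z y) i) has_derivative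
    (\<lambda>h. - (1 / N) *\<^sub>R ((q \<bullet> q) *\<^sub>R (P *v h) + (h \<bullet> (P *v q)) *\<^sub>R q
          + (q \<bullet> dev (Z y) i) *\<^sub>R (P *v (P *v h)) + (h \<bullet> q) *\<^sub>R (P *v q))
        + (1 - 1 / N) *\<^sub>R (P *v (P *v h)))) (at y)"
proof -
  let ?P' = "\<lambda>h. - (1 / N) *\<^sub>R (outer (P *v h) q + outer q (P *v h))"
  have P': "((\<lambda>y. precision (Z y)) has_derivative ?P') (at y)"
    unfolding P_def q_def N_def Z_def
    by (rule has_derivative_precision_set_row) (rule Z[unfolded Z_def])
  have Y': "((\<lambda>y. dev (Z y) i) has_derivative (\<lambda>h. h - (1 / N) *\<^sub>R h)) (at y)"
    using has_derivative_dev_set_row[of X i i y] by (simp add: N_def Z_def)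
  have q': "((\<lambda>y. pdev (Z y) i) has_derivative
      (\<lambda>h. P *v (h - (1 / N) *\<^sub>R h) + ?P' h *v dev (Z y) i)) (at y)"
    unfolding pdev_def P_def
    by (intro has_derivative_matrix_vector_mult P'[unfolded P_def] Y')
  have "((\<lambda>y. precision (Z y) *v pdev (Z y) i) has_derivative
      (\<lambda>h. P *v (P *v (h - (1 / N) *\<^sub>R h) + ?P' h *v dev (Z y) i) + ?P' h *v q)) (at y)"
    using has_derivative_matrix_vector_mult[OF P' q'] by (simp add: P_def q_def)
  moreover have "(P *v h) \<bullet> q = h \<bullet> (P *v q)" "(P *v h) \<bullet> dev (Z y) i = h \<bullet> q" for h
    by (simp_all add: symmetric_inner_commute transpose_precision[OF Z] P_def q_def pdev_def)
  ultimately show ?thesis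
    by (elim has_derivative_eq_rhs)
      (simp add: fun_eq_iff algebra_simps matrix_vector_mult_scaleR minus_matrix_vector_mult
        matrix_vector_mult_minus scaleR_matrix_vector_assoc[symmetric])
qed

lemma has_derivative_lyapunov_row_gradient:
  defines "P \<equiv> precision (Z y)" and "q \<equiv> pdev (Z y) i" and "g \<equiv> gradient f (Z y $ i)"
    and "T \<equiv> trace (precision (Z y))"
  shows "((\<lambda>y. lyapunov_row_gradient f a i (Z y)) has_derivative
    (\<lambda>h. exp (a / N * (\<Sum>j\<in>UNIV. f (Z y $ j))) *\<^sub>R
      ((a / N * (h \<bullet> g)) *\<^sub>R ((a / N * T) *\<^sub>R g - (2 / N) *\<^sub>R (P *v q))
       - (a / N * (2 / N) * (h \<bullet> (P *v q))) *\<^sub>R g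
       + (a / N * T) *\<^sub>R (hessian f (Z y $ i) *v h)
       - (2 / N) *\<^sub>R (- (1 / N) *\<^sub>R ((q \<bullet> q) *\<^sub>R (P *v h) + (h \<bullet> (P *v q)) *\<^sub>R q
          + (q \<bullet> dev (Z y) i) *\<^sub>R (P *v (P *v h)) + (h \<bullet> q) *\<^sub>R (P *v q))
        + (1 - 1 / N) *\<^sub>R (P *v (P *v h)))))) (at y)"
proof -
  have g': "((\<lambda>y. gradient f (Z y $ i)) has_derivative (\<lambda>h. hessian f (Z y $ i) *v h)) (at y)"
    using has_derivative_gradient[OF f] by (simp add: Z_def set_row_nth)
  show ?thesis
    unfolding lyapunov_row_gradient_def N_def[symmetric]
    by (rule has_derivative_eq_rhs, (rule has_derivative_scaleR has_derivative_diff
          has_derivative_scaleR_right has_derivative_mult_right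
          has_derivative_exp_potential has_derivative_trace_precision
          has_derivative_precision_pdev g')+)
      (simp add: fun_eq_iff P_def q_def g_def T_def algebra_simps)
qed

end

lemma row_gradient_lyapunov:
  assumes "C2 f" "X \<in> state_space"
  shows "row_gradient i (lyapunov f a) X = lyapunov_row_gradient f a i X"
  unfolding row_gradient_def
  using gradient_eqI[OF GDERIV_lyapunov[of f X i "X $ i" a]] assms by simp

text \<open>
  The matrix of second derivatives is never written out: by \<open>frobenius_ens_cov\<close> it is enough to pair the
  derivative of the gradient with each deviation and to average. The averages of products then
  collapse through \<open>C P = I\<close>.\<close>

lemma frobenius_row_hessian_lyapunov:
  fixes X :: "real^'d^'n" and f :: "real^'d \<Rightarrow> real" and i :: 'n and a :: real
  assumes f: "C2 f" and X: "X \<in> state_space"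
  defines "C \<equiv> ens_cov X" and "P \<equiv> precision X" and "q \<equiv> pdev X i" and "g \<equiv> gradient f (X $ i)"
    and "T \<equiv> trace (precision X)" and "N \<equiv> real CARD('n)"
  shows "C :\<^sub>F row_hessian i (lyapunov f a) X = exp (a / N * (\<Sum>j\<in>UNIV. f (X $ j))) *
    ((a / N)\<^sup>2 * T * (g \<bullet> (C *v g)) - 4 * a / N\<^sup>2 * (g \<bullet> q) + a / N * T * (C :\<^sub>F hessian f (X $ i))
     + 2 / N\<^sup>2 * ((real CARD('d) + 2) * (q \<bullet> q) + T * (dev X i \<bullet> q)) - 2 / N * (1 - 1 / N) * T)"
proof -
  let ?Z = "set_row X i"
  define E where "E = exp (a / N * (\<Sum>j\<in>UNIV. f (X $ j)))"
  define D where "D = (\<lambda>h. E *\<^sub>R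
      ((a / N * (h \<bullet> g)) *\<^sub>R ((a / N * T) *\<^sub>R g - (2 / N) *\<^sub>R (P *v q))
       - (a / N * (2 / N) * (h \<bullet> (P *v q))) *\<^sub>R g
       + (a / N * T) *\<^sub>R (hessian f (X $ i) *v h)
       - (2 / N) *\<^sub>R (- (1 / N) *\<^sub>R ((q \<bullet> q) *\<^sub>R (P *v h) + (h \<bullet> (P *v q)) *\<^sub>R q
          + (q \<bullet> dev X i) *\<^sub>R (P *v (P *v h)) + (h \<bullet> q) *\<^sub>R (P *v q))
        + (1 - 1 / N) *\<^sub>R (P *v (P *v h)))))"
  have "((\<lambda>y. lyapunov_row_gradient f a i (?Z y)) has_derivative D) (at (X $ i))"
    using has_derivative_lyapunov_row_gradient[of f X i "X $ i" a] f X
    by (simp add: D_def E_def C_def P_def q_def g_def T_def N_def)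
  then have D: "(gradient (\<lambda>y. lyapunov f a (?Z y)) has_derivative D) (at (X $ i))"
  proof (rule has_derivative_transform_within_open[OF _ open_row_slice])
    show "X $ i \<in> {y. ?Z y \<in> state_space}" using X by simp
    show "lyapunov_row_gradient f a i (?Z y) = gradient (\<lambda>y. lyapunov f a (?Z y)) y"
      if "y \<in> {y. ?Z y \<in> state_space}" for y
      using gradient_eqI[OF GDERIV_lyapunov[of f X i y a]] f that by simp
  qed
  have "row_hessian i (lyapunov f a) X = matrix D"
    unfolding row_hessian_def hessian_def jacobian_def frechet_derivative_at[OF D, symmetric] ..
  moreover have "matrix D *v h = D h" for h
    using has_derivative_linear[OF D] by (simp add: matrix_works)
  ultimately have "C :\<^sub>F row_hessian i (lyapunov f a) X = avg (\<lambda>j. dev X j \<bullet> D (dev X j))"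
    by (simp add: C_def frobenius_ens_cov)
  also have "\<dots> = avg (\<lambda>j. E * ((a / N)\<^sup>2 * T * ((dev X j \<bullet> g) * (dev X j \<bullet> g))
      - (4 * a / N\<^sup>2) * ((dev X j \<bullet> g) * (dev X j \<bullet> (P *v q)))
      + a / N * T * (dev X j \<bullet> (hessian f (X $ i) *v dev X j))
      + 2 / N\<^sup>2 * ((q \<bullet> q) * (dev X j \<bullet> pdev X j) + 2 * ((dev X j \<bullet> q) * (dev X j \<bullet> (P *v q)))
          + (q \<bullet> dev X i) * (pdev X j \<bullet> pdev X j))
      - 2 / N * (1 - 1 / N) * (pdev X j \<bullet> pdev X j)))"
  proof (intro arg_cong[of _ _ avg] ext)
    fix j
    have "dev X j \<bullet> (P *v (P *v dev X j)) = pdev X j \<bullet> pdev X j"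
      by (metis P_def X pdev_def symmetric_inner_commute transpose_precision)
    moreover have "P *v dev X j = pdev X j"
      by (simp add: P_def pdev_def)
    ultimately show "dev X j \<bullet> D (dev X j) = E * ((a / N)\<^sup>2 * T * ((dev X j \<bullet> g) * (dev X j \<bullet> g))
      - (4 * a / N\<^sup>2) * ((dev X j \<bullet> g) * (dev X j \<bullet> (P *v q)))
      + a / N * T * (dev X j \<bullet> (hessian f (X $ i) *v dev X j))
      + 2 / N\<^sup>2 * ((q \<bullet> q) * (dev X j \<bullet> pdev X j) + 2 * ((dev X j \<bullet> q) * (dev X j \<bullet> (P *v q)))
          + (q \<bullet> dev X i) * (pdev X j \<bullet> pdev X j))
      - 2 / N * (1 - 1 / N) * (pdev X j \<bullet> pdev X j))"
      unfolding D_def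
      by (simp add: inner_diff_right inner_add_right power2_eq_square algebra_simps
          add_divide_distrib diff_divide_distrib)
  qed
  also have "\<dots> = E * ((a / N)\<^sup>2 * T * (g \<bullet> (C *v g)) - (4 * a / N\<^sup>2) * (g \<bullet> (C *v (P *v q)))
      + a / N * T * (C :\<^sub>F hessian f (X $ i))
      + 2 / N\<^sup>2 * ((q \<bullet> q) * real CARD('d) + 2 * (q \<bullet> (C *v (P *v q))) + (q \<bullet> dev X i) * T)
      - 2 / N * (1 - 1 / N) * T)"
    by (simp only: avg_cmult avg_add avg_diff C_def inner_ens_cov[symmetric] avg_dev_pdev[OF X]
        frobenius_ens_cov[symmetric] trace_precision[OF X, symmetric] T_def)
  also have "C *v (P *v q) = q"
    by (simp add: C_def P_def X)
  finally show ?thesis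
    by (simp add: E_def algebra_simps inner_commute)
qed

text \<open>
  The generator relative to the exponential factor. The constant \<open>-2(N-d-2)/N\<close> is what the diffusion and
  the correction drift contribute to \<open>Tr C\<^sup>-\<^sup>1\<close>; it is negative exactly when \<open>N > d + 2\<close>. The term
  \<open>avg (g\<^sub>i \<bullet> C g\<^sub>i)\<close> is the dissipation of the potential. The last average, the only term without the
  factor \<open>Tr C\<^sup>-\<^sup>1\<close>, collects the force acting on \<open>Tr C\<^sup>-\<^sup>1\<close> and the mixed
  derivatives of the two factors.\<close>

lemma generator_lyapunov:
  fixes X :: "real^'d^'n" and f :: "real^'d \<Rightarrow> real" and a :: real
  assumes f: "C2 f" and X: "X \<in> state_space"
  defines "N \<equiv> real CARD('n)" and "d \<equiv> real CARD('d)" and "g \<equiv> (\<lambda>i. gradient f (X $ i))"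
  shows "generator f (lyapunov f a) X = exp (a / N * (\<Sum>i\<in>UNIV. f (X $ i))) *
    (trace (precision X) *
      (- (a - a\<^sup>2 / N) * avg (\<lambda>i. g i \<bullet> (ens_cov X *v g i))
       + a * (d + 1) / N * avg (\<lambda>i. g i \<bullet> dev X i)
       + a * avg (\<lambda>i. ens_cov X :\<^sub>F hessian f (X $ i))
       - 2 * (N - d - 2) / N)
     + (2 - 4 * a / N) * avg (\<lambda>i. g i \<bullet> pdev X i))"
proof -
  define C where "C = ens_cov X"
  define P where "P = precision X"
  define T where "T = trace (precision X)"
  define E where "E = exp (a / N * (\<Sum>i\<in>UNIV. f (X $ i)))"
  have N: "N > 0" by (simp add: N_def)
  have collect: "N * (E * (- (a / N) * T * G + 2 / N * Q + (d + 1) / N * (a / N * T * A - 2 / N * T)))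
      + N * (E * ((a / N)\<^sup>2 * T * G - 4 * a / N\<^sup>2 * Q + a / N * T * H
         + 2 / N\<^sup>2 * ((d + 2) * T + T * d) - 2 / N * (1 - 1 / N) * T))
      = E * (T * (- (a - a\<^sup>2 / N) * G + a * (d + 1) / N * A + a * H - 2 * (N - d - 2) / N)
         + (2 - 4 * a / N) * Q)" for G Q A H
    using N by (simp add: field_simps power2_eq_square)
  have drift: "drift f X i \<bullet> row_gradient i (lyapunov f a) X
      = E * (- (a / N) * T * (g i \<bullet> (C *v g i)) + 2 / N * (g i \<bullet> pdev X i)
        + (d + 1) / N * (a / N * T * (g i \<bullet> dev X i) - 2 / N * (pdev X i \<bullet> pdev X i)))" for i
  proof -
    have "(C *v g i) \<bullet> (P *v pdev X i) = g i \<bullet> pdev X i"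
      by (simp add: C_def P_def X symmetric_inner_commute)
    moreover have "(P *v pdev X i) \<bullet> dev X i = pdev X i \<bullet> pdev X i"
      by (simp add: P_def X pdev_def symmetric_inner_commute)
    moreover have "drift f X i = - (C *v g i) + ((d + 1) / N) *\<^sub>R dev X i"
      by (simp add: drift_def C_def g_def dev_def d_def N_def)
    moreover have "row_gradient i (lyapunov f a) X
        = E *\<^sub>R ((a / N * T) *\<^sub>R g i - (2 / N) *\<^sub>R (P *v pdev X i))"
      by (simp add: row_gradient_lyapunov f X lyapunov_row_gradient_def E_def N_def T_def g_def P_def)
    moreover have "(C *v g i) \<bullet> g i = g i \<bullet> (C *v g i)" "dev X i \<bullet> g i = g i \<bullet> dev X i"
        "dev X i \<bullet> (P *v pdev X i) = (P *v pdev X i) \<bullet> dev X i"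
      by (simp_all only: inner_commute)
    ultimately show ?thesis
      by (simp only: inner_diff_right inner_add_left inner_minus_left inner_scaleR_left
          inner_scaleR_right) (simp add: algebra_simps add_divide_distrib diff_divide_distrib)
  qed
  have "generator f (lyapunov f a) X
      = (\<Sum>i\<in>UNIV. E * (- (a / N) * T * (g i \<bullet> (C *v g i)) + 2 / N * (g i \<bullet> pdev X i)
        + (d + 1) / N * (a / N * T * (g i \<bullet> dev X i) - 2 / N * (pdev X i \<bullet> pdev X i))))
      + (\<Sum>i\<in>UNIV. E * ((a / N)\<^sup>2 * T * (g i \<bullet> (C *v g i)) - 4 * a / N\<^sup>2 * (g i \<bullet> pdev X i)
         + a / N * T * (C :\<^sub>F hessian f (X $ i))
         + 2 / N\<^sup>2 * ((d + 2) * (pdev X i \<bullet> pdev X i) + T * (dev X i \<bullet> pdev X i))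
         - 2 / N * (1 - 1 / N) * T))"
    unfolding generator_def drift
    by (simp only: frobenius_row_hessian_lyapunov[OF f X] C_def E_def T_def N_def g_def d_def)
  also have "\<dots> = N * (E * (- (a / N) * T * avg (\<lambda>i. g i \<bullet> (C *v g i))
         + 2 / N * avg (\<lambda>i. g i \<bullet> pdev X i)
        + (d + 1) / N * (a / N * T * avg (\<lambda>i. g i \<bullet> dev X i) - 2 / N * T)))
      + N * (E * ((a / N)\<^sup>2 * T * avg (\<lambda>i. g i \<bullet> (C *v g i)) - 4 * a / N\<^sup>2 * avg (\<lambda>i. g i \<bullet> pdev X i)
         + a / N * T * avg (\<lambda>i. C :\<^sub>F hessian f (X $ i))
         + 2 / N\<^sup>2 * ((d + 2) * T + T * d)
         - 2 / N * (1 - 1 / N) * T))"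
    by (simp only: sum_eq_avg N_def[symmetric] avg_cmult avg_add avg_diff avg_const T_def
        trace_precision[OF X, symmetric] avg_dev_pdev[OF X] d_def)
  also have "\<dots> = E * (T *
      (- (a - a\<^sup>2 / N) * avg (\<lambda>i. g i \<bullet> (C *v g i))
       + a * (d + 1) / N * avg (\<lambda>i. g i \<bullet> dev X i)
       + a * avg (\<lambda>i. C :\<^sub>F hessian f (X $ i))
       - 2 * (N - d - 2) / N)
     + (2 - 4 * a / N) * avg (\<lambda>i. g i \<bullet> pdev X i))"
    by (rule collect)
  finally show ?thesis
    unfolding E_def C_def T_def .
qed

section \<open>Potentials with uniformly convex tails\<close>

lemma gradient_lipschitz:
  fixes f :: "real^'d \<Rightarrow> real"
  assumes "C2 f" "\<And>x. op_norm (hessian f x) \<le> L"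
  shows "norm (gradient f x - gradient f y) \<le> L * norm (x - y)"
proof (rule differentiable_bound)
  show "(gradient f has_derivative (\<lambda>h. hessian f z *v h)) (at z within UNIV)" for z
    using has_derivative_gradient[OF assms(1)] by simp
  show "onorm (\<lambda>h. hessian f z *v h) \<le> L" for z
    using assms(2)[of z] by (simp add: op_norm_def)
qed auto

lemma hessian_quadratic_bound:
  fixes f :: "real^'d \<Rightarrow> real"
  assumes "op_norm (hessian f x) \<le> L"
  shows "\<bar>v \<bullet> (hessian f x *v v)\<bar> \<le> L * (v \<bullet> v)"
proof -
  have "norm (hessian f x *v v) \<le> op_norm (hessian f x) * norm v"
    unfolding op_norm_def by (rule onorm) simp
  also have "\<dots> \<le> L * norm v"
    by (rule mult_right_mono[OF assms]) simp
  finally have "norm v * norm (hessian f x *v v) \<le> norm v * (L * norm v)"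
    by (rule mult_left_mono) simp
  then show ?thesis
    using Cauchy_Schwarz_ineq2[of v "hessian f x *v v"]
    by (simp add: dot_square_norm power2_eq_square mult_ac)
qed

text \<open>
  The exceptional set is compensated by a bounded field: \<open>x / sqrt (1 + |x|\<^sup>2)\<close> is monotone, its
  derivative dominates a positive multiple of the identity on every bounded set, and its norm is below one. Adding a
  multiple \<open>M\<close> of it to the gradient gives a field that is \<open>\<mu>\<close>-monotone everywhere, and removing
  it again costs only \<open>2 M |x - y|\<close>, which is absorbed by the quadratic term.\<close>

lemma gradient_monotone_up_to_constant:
  fixes f :: "real^'d \<Rightarrow> real"
  assumes f: "C2 f" and L: "\<And>x. op_norm (hessian f x) \<le> L" "L > 0"
    and mu: "\<mu> > 0" and B: "compact B" "\<And>x. x \<notin> B \<Longrightarrow> hessian f x \<succeq> \<mu> *\<^sub>R mat 1"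
  obtains c where "c \<ge> 0"
    "\<And>x y. (gradient f x - gradient f y) \<bullet> (x - y) \<ge> \<mu> / 2 * (norm (x - y))\<^sup>2 - c"
proof -
  obtain b where b: "\<And>x. x \<in> B \<Longrightarrow> norm x \<le> b"
    using compact_imp_bounded[OF B(1)] by (auto simp: bounded_iff)
  define R where "R = sqrt (1 + b\<^sup>2)"
  \<comment> \<open>on \<open>B\<close> the derivative of the added field is at least \<open>M / R ^ 3\<close>, which outweighs \<open>- L\<close> by \<open>\<mu>\<close>\<close>
  define M where "M = (L + \<mu>) * R ^ 3"
  have R: "R > 0" by (simp add: R_def add_pos_nonneg)
  have M: "M > 0" using R mu L(2) by (simp add: M_def)
  have main: "(gradient f x - gradient f y) \<bullet> (x - y) \<ge> \<mu> * (norm (x - y))\<^sup>2 - 2 * M * norm (x - y)"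
    for x y
  proof -
    define h where "h = x - y"
    define p where "p t = y + t *\<^sub>R h" for t :: real
    define r where "r t = sqrt (1 + p t \<bullet> p t)" for t
    define w where "w t = (p t \<bullet> h) / r t" for t
    \<comment> \<open>the corrected field along the segment, minus its required growth; the claim is that \<open>\<phi>\<close> increases\<close>
    define \<phi> where "\<phi> t = gradient f (p t) \<bullet> h + M * w t - \<mu> * (h \<bullet> h) * t" for t
    have r: "r t > 0" "r t \<ge> 1" "(r t)\<^sup>2 = 1 + p t \<bullet> p t" for t
      by (auto simp: r_def add_pos_nonneg)
    have p': "(p has_vector_derivative h) (at t)" for t
      unfolding p_def by (auto intro!: derivative_eq_intros)
    have u': "((\<lambda>t. p t \<bullet> h) has_real_derivative h \<bullet> h) (at t)" for t
      unfolding p_def by (auto intro!: derivative_eq_intros simp: inner_add_left)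
    have pp': "((\<lambda>t. p t \<bullet> p t) has_real_derivative 2 * (p t \<bullet> h)) (at t)" for t
      unfolding p_def
      by (auto intro!: derivative_eq_intros
          simp: inner_add_left inner_add_right inner_commute algebra_simps)
    have r': "(r has_real_derivative (p t \<bullet> h) / r t) (at t)" for t
    proof -
      have "((\<lambda>t. 1 + p t \<bullet> p t) has_real_derivative 2 * (p t \<bullet> h)) (at t)"
        using DERIV_add[OF DERIV_const[of 1] pp'[of t]] by simp
      then have "(r has_real_derivative inverse (r t) / 2 * (2 * (p t \<bullet> h))) (at t)"
        unfolding r_def by (rule DERIV_chain2[rotated]) (simp add: DERIV_real_sqrt add_pos_nonneg)
      then show ?thesis by (simp add: field_simps)
    qed
    have w': "(w has_real_derivative (h \<bullet> h) / r t - (p t \<bullet> h)\<^sup>2 / (r t) ^ 3) (at t)" for t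
      unfolding w_def
      by (rule derivative_eq_intros u' r' refl)+
        (use r(1)[of t] in \<open>auto simp: field_simps power2_eq_square power3_eq_cube\<close>)
    have w'_lower: "(h \<bullet> h) / (r t) ^ 3 \<le> (h \<bullet> h) / r t - (p t \<bullet> h)\<^sup>2 / (r t) ^ 3" for t
    proof -
      have "h \<bullet> h + (p t \<bullet> h)\<^sup>2 \<le> h \<bullet> h * (r t)\<^sup>2"
        using Cauchy_Schwarz_ineq[of "p t" h] by (simp add: r(3) algebra_simps)
      then have "(h \<bullet> h + (p t \<bullet> h)\<^sup>2) / (r t) ^ 3 \<le> (h \<bullet> h * (r t)\<^sup>2) / (r t) ^ 3"
        using r(1)[of t] by (intro divide_right_mono) auto
      also have "\<dots> = (h \<bullet> h) / r t"
        using r(1)[of t] by (simp add: power2_eq_square power3_eq_cube)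
      finally show ?thesis by (simp add: add_divide_distrib)
    qed
    have g': "((\<lambda>t. gradient f (p t) \<bullet> h) has_real_derivative h \<bullet> (hessian f (p t) *v h)) (at t)" for t
    proof -
      have "((\<lambda>t. gradient f (p t)) has_derivative (\<lambda>s. hessian f (p t) *v (s *\<^sub>R h))) (at t)"
        using p'[of t] unfolding has_vector_derivative_def
        by (rule has_derivative_compose[OF _ has_derivative_gradient[OF f]])
      then have "((\<lambda>t. gradient f (p t) \<bullet> h) has_derivative
          (\<lambda>s. (hessian f (p t) *v (s *\<^sub>R h)) \<bullet> h)) (at t)"
        by (rule has_derivative_inner_left)
      then show ?thesis
        unfolding has_field_derivative_def
        by (rule has_derivative_eq_rhs)
          (simp add: fun_eq_iff matrix_vector_mult_scaleR inner_commute)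
    qed
    have \<phi>': "(\<phi> has_real_derivative h \<bullet> (hessian f (p t) *v h)
        + M * ((h \<bullet> h) / r t - (p t \<bullet> h)\<^sup>2 / (r t) ^ 3) - \<mu> * (h \<bullet> h)) (at t)" for t
      unfolding \<phi>_def by (rule derivative_eq_intros g' w' refl)+ simp
    have "h \<bullet> (hessian f (p t) *v h)
        + M * ((h \<bullet> h) / r t - (p t \<bullet> h)\<^sup>2 / (r t) ^ 3) - \<mu> * (h \<bullet> h) \<ge> 0" for t
    proof (cases "p t \<in> B")
      case True
      have "norm (p t) \<le> b" by (rule b[OF True])
      then have "(norm (p t))\<^sup>2 \<le> b\<^sup>2" by (rule power_mono) simp
      then have "r t \<le> R" by (simp add: r_def R_def dot_square_norm)
      then have "(r t) ^ 3 \<le> R ^ 3" using r(1)[of t] by (intro power_mono) auto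
      then have "(h \<bullet> h) / R ^ 3 \<le> (h \<bullet> h) / (r t) ^ 3"
        using r(1)[of t] R by (intro divide_left_mono) auto
      then have "M * ((h \<bullet> h) / R ^ 3) \<le> M * ((h \<bullet> h) / r t - (p t \<bullet> h)\<^sup>2 / (r t) ^ 3)"
        using w'_lower[of t] M by (intro mult_left_mono) auto
      moreover have "M * ((h \<bullet> h) / R ^ 3) = (L + \<mu>) * (h \<bullet> h)"
        using R by (simp add: M_def)
      ultimately show ?thesis
        using hessian_quadratic_bound[OF L(1)[of "p t"], of h] by (simp add: algebra_simps)
    next
      case False
      then have "0 \<le> h \<bullet> ((hessian f (p t) - \<mu> *\<^sub>R mat 1) *v h)"
        using B(2) by (auto simp: loewner_ge_def)
      then have "\<mu> * (h \<bullet> h) \<le> h \<bullet> (hessian f (p t) *v h)"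
        by (simp add: matrix_vector_mult_diff_rdistrib inner_diff_right
            scaleR_matrix_vector_assoc[symmetric])
      moreover have "0 \<le> (h \<bullet> h) / (r t) ^ 3"
        using r(1)[of t] by simp
      then have "0 \<le> M * ((h \<bullet> h) / r t - (p t \<bullet> h)\<^sup>2 / (r t) ^ 3)"
        using w'_lower[of t] M by (intro mult_nonneg_nonneg) auto
      ultimately show ?thesis by linarith
    qed
    then have "\<exists>y. (\<phi> has_real_derivative y) (at t) \<and> 0 \<le> y" for t
      using \<phi>'[of t] by blast
    then have "\<phi> 0 \<le> \<phi> 1"
      by (intro DERIV_nonneg_imp_nondecreasing[of 0 1 \<phi>]) auto
    moreover have w_bound: "\<bar>w t\<bar> \<le> norm h" for t
    proof -
      have "norm (p t) \<le> r t"
        unfolding r_def norm_eq_sqrt_inner by simp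
      then have "\<bar>p t \<bullet> h\<bar> \<le> r t * norm h"
        using Cauchy_Schwarz_ineq2[of "p t" h] by (meson mult_right_mono norm_ge_zero order.trans)
      then show ?thesis
        using r(1)[of t] by (simp add: w_def divide_le_eq mult.commute)
    qed
    have "M * w 1 - M * w 0 \<le> M * (2 * norm h)"
      unfolding right_diff_distrib[symmetric]
      using M w_bound[of 0] w_bound[of 1] by (intro mult_left_mono) auto
    ultimately show ?thesis
      unfolding \<phi>_def by (simp add: p_def h_def inner_diff_left dot_square_norm)
  qed
  show thesis
  proof (rule that[of "2 * M\<^sup>2 / \<mu>"])
    show "2 * M\<^sup>2 / \<mu> \<ge> 0" using mu by simp
    fix x y :: "real^'d"
    have "0 \<le> (\<mu> * norm (x - y) - 2 * M)\<^sup>2 / (2 * \<mu>)"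
      using mu by simp
    also have "\<dots> = \<mu> / 2 * (norm (x - y))\<^sup>2 - 2 * M * norm (x - y) + 2 * M\<^sup>2 / \<mu>"
      using mu by (simp add: field_simps power2_eq_square)
    finally show "(gradient f x - gradient f y) \<bullet> (x - y) \<ge> \<mu> / 2 * (norm (x - y))\<^sup>2 - 2 * M\<^sup>2 / \<mu>"
      using main[of x y] by simp
  qed
qed

text \<open>
  Monotonicity towards the origin bounds \<open>|g(x) - g(0)| |x|\<close> below by a quadratic in \<open>|x|\<close>, which
  forces linear growth of the field.\<close>

lemma gradient_coercive:
  fixes g :: "real^'d \<Rightarrow> real^'d"
  assumes mu: "\<mu> > 0"
    and mono: "\<And>x y. (g x - g y) \<bullet> (x - y) \<ge> \<mu> / 2 * (norm (x - y))\<^sup>2 - c"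
  shows "(norm (g x))\<^sup>2 \<ge> \<mu>\<^sup>2 / 8 * (norm x)\<^sup>2 - (\<mu> * c / 2 + (norm (g 0))\<^sup>2)"
proof -
  define v where "v = g x - g 0"
  have "\<mu> / 2 * (norm x)\<^sup>2 - c \<le> norm v * norm x"
    using mono[of x 0] norm_cauchy_schwarz[of v x] by (simp add: v_def)
  moreover have "0 \<le> (\<mu> * norm x - 2 * norm v)\<^sup>2"
    by simp
  moreover have "(\<mu> * norm x - 2 * norm v)\<^sup>2
      = \<mu>\<^sup>2 * (norm x)\<^sup>2 - 4 * (\<mu> * (norm v * norm x)) + 4 * (norm v)\<^sup>2"
    by (simp add: power2_eq_square algebra_simps)
  ultimately have *: "\<mu>\<^sup>2 * (norm x)\<^sup>2 \<le> 4 * \<mu> * c + 4 * (norm v)\<^sup>2"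
    using mult_left_mono[of "\<mu> / 2 * (norm x)\<^sup>2 - c" "norm v * norm x" "4 * \<mu>"] mu
    by (simp add: power2_eq_square algebra_simps)
  have "(norm v)\<^sup>2 \<le> 2 * (norm (g x))\<^sup>2 + 2 * (norm (g 0))\<^sup>2"
  proof -
    have "0 \<le> (g x + g 0) \<bullet> (g x + g 0)" by simp
    then show ?thesis
      unfolding v_def power2_norm_eq_inner
      by (simp add: inner_diff_left inner_diff_right inner_add_left inner_add_right inner_commute)
  qed
  with * show ?thesis by (simp add: algebra_simps)
qed

section \<open>Moment estimates for an ensemble\<close>

text \<open>
  As the deviations sum to zero, the value of the field at the mean can be subtracted, so that
  only differences \<open>g(x\<^sub>i) - g(mean)\<close> enter.\<close>

lemma avg_gradient_dev_bounds:
  fixes X :: "real^'d^'n" and g :: "real^'d \<Rightarrow> real^'d"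
  assumes lip: "\<And>x y. norm (g x - g y) \<le> L * norm (x - y)"
    and mono: "\<And>x y. (g x - g y) \<bullet> (x - y) \<ge> m * (norm (x - y))\<^sup>2 - c"
  shows "avg (\<lambda>i. g (X $ i) \<bullet> dev X i) \<le> L * avg (\<lambda>i. dev X i \<bullet> dev X i)"
    and "avg (\<lambda>i. g (X $ i) \<bullet> dev X i) \<ge> m * avg (\<lambda>i. dev X i \<bullet> dev X i) - c"
proof -
  let ?v = "\<lambda>i. g (X $ i) - g (ens_mean X)"
  have centre: "avg (\<lambda>i. g (X $ i) \<bullet> dev X i) = avg (\<lambda>i. ?v i \<bullet> dev X i)"
    by (simp add: inner_diff_left avg_diff avg_inner_dev)
  have "?v i \<bullet> dev X i \<le> L * (dev X i \<bullet> dev X i)" for i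
  proof -
    have "?v i \<bullet> dev X i \<le> norm (?v i) * norm (dev X i)"
      by (rule norm_cauchy_schwarz)
    also have "\<dots> \<le> L * norm (dev X i) * norm (dev X i)"
      using lip[of "X $ i" "ens_mean X"] by (intro mult_right_mono) (auto simp: dev_def)
    finally show ?thesis by (simp add: dot_square_norm power2_eq_square)
  qed
  then show "avg (\<lambda>i. g (X $ i) \<bullet> dev X i) \<le> L * avg (\<lambda>i. dev X i \<bullet> dev X i)"
    unfolding centre avg_cmult[symmetric] by (rule avg_mono)
  have "m * avg (\<lambda>i. dev X i \<bullet> dev X i) - c = avg (\<lambda>i. m * (dev X i \<bullet> dev X i) - c)"
    by (simp add: avg_diff avg_cmult)
  also have "\<dots> \<le> avg (\<lambda>i. ?v i \<bullet> dev X i)"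
    using mono[of _ "ens_mean X"] by (intro avg_mono) (simp add: dev_def dot_square_norm)
  finally show "avg (\<lambda>i. g (X $ i) \<bullet> dev X i) \<ge> m * avg (\<lambda>i. dev X i \<bullet> dev X i) - c"
    unfolding centre .
qed

text \<open>
  The weight \<open>\<theta>\<close> of the arithmetic--geometric mean inequality is left free: a choice proportional to the
  spread gives a bound that is linear in the spread relative to \<open>Tr C\<^sup>-\<^sup>1\<close>, and a small constant gives one that is useful
  when \<open>Tr C\<^sup>-\<^sup>1\<close> is large.\<close>

lemma avg_gradient_pdev_bound:
  fixes X :: "real^'d^'n" and g :: "real^'d \<Rightarrow> real^'d"
  assumes X: "X \<in> state_space" and lip: "\<And>x y. norm (g x - g y) \<le> L * norm (x - y)"
    and "L \<ge> 0" and \<theta>: "\<theta> > 0"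
  shows "2 * \<bar>avg (\<lambda>i. g (X $ i) \<bullet> pdev X i)\<bar>
    \<le> L * (\<theta> * trace (precision X) + avg (\<lambda>i. dev X i \<bullet> dev X i) / \<theta>)"
proof -
  let ?v = "\<lambda>i. g (X $ i) - g (ens_mean X)"
  have "avg (\<lambda>i. u \<bullet> pdev X i) = 0" for u
    using avg_inner_dev[of "precision X *v u" X]
    by (simp add: pdev_def symmetric_inner_commute X)
  then have centre: "avg (\<lambda>i. g (X $ i) \<bullet> pdev X i) = avg (\<lambda>i. ?v i \<bullet> pdev X i)"
    by (simp add: inner_diff_left avg_diff)
  have term_bound: "2 * \<bar>?v i \<bullet> pdev X i\<bar> \<le> L * (\<theta> * (pdev X i \<bullet> pdev X i) + (dev X i \<bullet> dev X i) / \<theta>)"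
    for i
  proof -
    have "\<bar>?v i \<bullet> pdev X i\<bar> \<le> norm (?v i) * norm (pdev X i)"
      by (rule Cauchy_Schwarz_ineq2)
    also have "\<dots> \<le> L * norm (dev X i) * norm (pdev X i)"
      using lip[of "X $ i" "ens_mean X"] by (intro mult_right_mono) (auto simp: dev_def)
    finally have "2 * \<bar>?v i \<bullet> pdev X i\<bar> \<le> L * (2 * norm (dev X i) * norm (pdev X i))"
      by simp
    also have "\<dots> \<le> L * (\<theta> * (norm (pdev X i))\<^sup>2 + (norm (dev X i))\<^sup>2 / \<theta>)"
    proof (rule mult_left_mono)
      have "0 \<le> (\<theta> * norm (pdev X i) - norm (dev X i))\<^sup>2 / \<theta>"
        using \<theta> by simp
      also have "\<dots> = \<theta> * (norm (pdev X i))\<^sup>2 + (norm (dev X i))\<^sup>2 / \<theta>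
          - 2 * norm (dev X i) * norm (pdev X i)"
        using \<theta> by (simp add: field_simps power2_eq_square)
      finally show "2 * norm (dev X i) * norm (pdev X i)
          \<le> \<theta> * (norm (pdev X i))\<^sup>2 + (norm (dev X i))\<^sup>2 / \<theta>"
        by simp
    qed fact
    finally show ?thesis by (simp add: dot_square_norm)
  qed
  have "2 * \<bar>avg (\<lambda>i. ?v i \<bullet> pdev X i)\<bar> \<le> avg (\<lambda>i. 2 * \<bar>?v i \<bullet> pdev X i\<bar>)"
  proof -
    have "\<bar>\<Sum>i\<in>UNIV. ?v i \<bullet> pdev X i\<bar> \<le> (\<Sum>i\<in>UNIV. \<bar>?v i \<bullet> pdev X i\<bar>)"
      by (rule sum_abs)
    then show ?thesis
      unfolding avg_cmult by (simp add: avg_def divide_right_mono)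
  qed
  also have "\<dots> \<le> avg (\<lambda>i. L * (\<theta> * (pdev X i \<bullet> pdev X i) + (1 / \<theta>) * (dev X i \<bullet> dev X i)))"
    using term_bound by (intro avg_mono) simp
  also have "\<dots> = L * (\<theta> * trace (precision X) + avg (\<lambda>i. dev X i \<bullet> dev X i) / \<theta>)"
    by (simp only: avg_cmult avg_add trace_precision[OF X]) simp
  finally show ?thesis
    unfolding centre .
qed

text \<open>
  Positivity of the form \<open>C\<close> at \<open>v\<^sub>i - t C\<^sup>-\<^sup>1 y\<^sub>i\<close>, averaged over the particles. Optimising over \<open>t\<close> gives
  \<open>(avg (v\<^sub>i \<bullet> y\<^sub>i))\<^sup>2 / d\<close>.\<close>

lemma avg_force_lower_bound:
  fixes X :: "real^'d^'n" and v :: "'n \<Rightarrow> real^'d"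
  assumes X: "X \<in> state_space"
  shows "2 * t * avg (\<lambda>i. v i \<bullet> dev X i) - t\<^sup>2 * real CARD('d)
    \<le> avg (\<lambda>i. v i \<bullet> (ens_cov X *v v i))"
proof -
  let ?C = "ens_cov X"
  have "0 \<le> avg (\<lambda>i. (v i - t *\<^sub>R pdev X i) \<bullet> (?C *v (v i - t *\<^sub>R pdev X i)))"
    by (intro avg_nonneg) (simp add: inner_ens_cov avg_nonneg)
  also have "\<dots> = avg (\<lambda>i. v i \<bullet> (?C *v v i) - 2 * t * (v i \<bullet> dev X i) + t\<^sup>2 * (dev X i \<bullet> pdev X i))"
  proof (intro arg_cong[of _ _ avg] ext)
    fix i
    have "pdev X i \<bullet> (?C *v v i) = v i \<bullet> dev X i"
      by (metis X ens_cov_pdev inner_commute symmetric_inner_commute transpose_ens_cov)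
    then show "(v i - t *\<^sub>R pdev X i) \<bullet> (?C *v (v i - t *\<^sub>R pdev X i))
        = v i \<bullet> (?C *v v i) - 2 * t * (v i \<bullet> dev X i) + t\<^sup>2 * (dev X i \<bullet> pdev X i)"
      by (simp add: matrix_vector_mult_diff_distrib matrix_vector_mult_scaleR X inner_diff_left
          inner_diff_right power2_eq_square inner_commute[of "pdev X i"] algebra_simps)
  qed
  also have "\<dots> = avg (\<lambda>i. v i \<bullet> (?C *v v i)) - 2 * t * avg (\<lambda>i. v i \<bullet> dev X i) + t\<^sup>2 * real CARD('d)"
    by (simp only: avg_add avg_diff avg_cmult avg_dev_pdev[OF X])
  finally show ?thesis by simp
qed

text \<open>
  The key gain: \<open>avg (g\<^sub>i \<bullet> y\<^sub>i)\<close> grows linearly in the spread \<open>s = Tr C\<close>, and the dissipation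
  controls its square. Preconditioning by \<open>C\<close> thus makes the dissipation quadratic in \<open>s\<close>, whereas all terms
  of the wrong sign are at most linear in \<open>s\<close>, relative to \<open>Tr C\<^sup>-\<^sup>1\<close>.\<close>

lemma avg_force_quadratic_lower_bound:
  fixes X :: "real^'d^'n" and g :: "real^'d \<Rightarrow> real^'d"
  assumes X: "X \<in> state_space" and m: "m \<ge> 0"
    and mono: "\<And>x y. (g x - g y) \<bullet> (x - y) \<ge> m * (norm (x - y))\<^sup>2 - c"
    and lip: "\<And>x y. norm (g x - g y) \<le> L * norm (x - y)"
  defines "s \<equiv> avg (\<lambda>i. dev X i \<bullet> dev X i)" and "d \<equiv> real CARD('d)"
  shows "m\<^sup>2 / d * s\<^sup>2 - 2 * m * c / d * s \<le> avg (\<lambda>i. g (X $ i) \<bullet> (ens_cov X *v g (X $ i)))"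
proof -
  \<comment> \<open>the optimal weight when the average is replaced by its leading part \<open>m * s\<close>\<close>
  define t where "t = m * s / d"
  have d: "d > 0" by (simp add: d_def)
  have s: "s \<ge> 0" by (simp add: s_def avg_nonneg)
  have "m * s - c \<le> avg (\<lambda>i. g (X $ i) \<bullet> dev X i)"
    unfolding s_def by (rule avg_gradient_dev_bounds(2)[OF lip mono])
  then have "2 * t * (m * s - c) \<le> 2 * t * avg (\<lambda>i. g (X $ i) \<bullet> dev X i)"
    using m s d by (intro mult_left_mono) (auto simp: t_def)
  moreover have "2 * t * (m * s - c) - t\<^sup>2 * d = m\<^sup>2 / d * s\<^sup>2 - 2 * m * c / d * s"
    using d by (simp add: t_def field_simps power2_eq_square)
  ultimately show ?thesis
    using avg_force_lower_bound[OF X, of t "\<lambda>i. g (X $ i)"] by (simp add: d_def)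
qed

lemma avg_norm_square: "avg (\<lambda>i. (norm (X $ i))\<^sup>2) = (norm X)\<^sup>2 / real CARD('n)"
  for X :: "real^'d^'n"
  by (simp add: avg_def power2_norm_eq_inner inner_vec_def[of X X])

text \<open>
  This detects ensembles that escape to infinity without spreading out or degenerating.\<close>

lemma avg_force_coercive:
  fixes X :: "real^'d^'n" and g :: "real^'d \<Rightarrow> real^'d"
  assumes X: "X \<in> state_space" and g: "\<And>x. (norm (g x))\<^sup>2 \<ge> e * (norm x)\<^sup>2 - k"
  shows "e * (norm X)\<^sup>2 / real CARD('n) - k
    \<le> trace (precision X) * avg (\<lambda>i. g (X $ i) \<bullet> (ens_cov X *v g (X $ i)))"
proof -
  have "e * (norm X)\<^sup>2 / real CARD('n) - k = avg (\<lambda>i. e * (norm (X $ i))\<^sup>2 - k)"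
    by (simp add: avg_diff avg_cmult avg_norm_square)
  also have "\<dots> \<le> avg (\<lambda>i. trace (precision X) * (g (X $ i) \<bullet> (ens_cov X *v g (X $ i))))"
    using order.trans[OF g, OF order.trans[OF eq_refl ens_cov_lower_bound[OF X]]]
    by (intro avg_mono) (simp add: dot_square_norm)
  finally show ?thesis by (simp only: avg_cmult)
qed

section \<open>The drift condition\<close>

text \<open>
  Adjoining the inverse \<open>P\<close> as a second variable turns the open condition \<open>det C > 0\<close> into the
  closed ones \<open>C P = I\<close> and \<open>det C \<ge> 0\<close>. The set is then the projection of a closed bounded set
  of pairs.\<close>

lemma compact_bounded_precision:
  fixes R R' :: real
  defines "K \<equiv> {X :: real^'d^'n. X \<in> state_space \<and> norm X \<le> R \<and> trace (precision X) \<le> R'}"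
  shows "compact K"
proof -
  define S where "S = {p :: (real^'d^'n) \<times> (real^'d^'d). ens_cov (fst p) ** snd p = mat 1
    \<and> 0 \<le> det (ens_cov (fst p)) \<and> norm (fst p) \<le> R \<and> norm (snd p) \<le> R' \<and> trace (snd p) \<le> R'}"
  have cov: "continuous_on UNIV (\<lambda>p :: (real^'d^'n) \<times> (real^'d^'d). ens_cov (fst p))"
    by (rule continuous_on_compose2[OF continuous_on_ens_cov continuous_on_fst]) auto
  have "closed S"
    unfolding S_def
    by (intro closed_Collect_conj closed_Collect_eq closed_Collect_le continuous_intros cov)
  moreover have "S \<subseteq> cball 0 R \<times> cball 0 R'"
    by (auto simp: S_def)
  then have "bounded S"
    by (rule bounded_subset[rotated]) (intro bounded_Times bounded_cball)
  ultimately have "compact (fst ` S)"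
    by (intro compact_continuous_image continuous_intros) (simp add: compact_eq_bounded_closed)
  moreover have "fst ` S = K"
  proof (intro equalityI subsetI)
    fix X assume "X \<in> fst ` S"
    then obtain P where P: "(X, P) \<in> S" by force
    have "det (ens_cov X) * det P = 1"
      using P by (metis (mono_tags, lifting) S_def det_I det_mul fst_conv mem_Collect_eq snd_conv)
    then have "det (ens_cov X) \<noteq> 0" by auto
    then have X: "X \<in> state_space"
      using P by (auto simp: S_def state_space_def)
    have "precision X = precision X ** (ens_cov X ** P)"
      using P by (simp add: S_def)
    also have "\<dots> = P"
      by (simp add: matrix_mul_assoc ens_cov_precision[OF X])
    finally show "X \<in> K"
      using P X by (simp add: S_def K_def)
  next
    fix X assume "X \<in> K"
    then have X: "X \<in> state_space" "norm X \<le> R" "trace (precision X) \<le> R'"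
      by (auto simp: K_def)
    then have "(X, precision X) \<in> S"
      using norm_precision_le_trace[OF X(1)]
      by (simp add: S_def ens_cov_precision state_space_def)
    then show "X \<in> fst ` S" by force
  qed
  ultimately show ?thesis by simp
qed

text \<open>
  Of the dissipation \<open>a G\<close>, one half pays for the second-order term \<open>a\<^sup>2 G / N\<close>, one quarter is traded
  for the quadratic lower bound in the spread, and one quarter is kept. The terms linear in \<open>s\<close> carry a factor
  \<open>a\<close> and are absorbed by \<open>a \<epsilon> s\<^sup>2 / 8\<close> at the price of a constant of order \<open>a\<close>, at most \<open>\<kappa> / 4\<close> when
  \<open>a\<close> is small.\<close>

lemma relative_generator_bound:
  fixes a L \<epsilon> k \<kappa> N d s T G A H Q B :: real
  assumes a: "0 < a" "a < N / 2" "8 * a * B\<^sup>2 \<le> \<kappa> * \<epsilon>" and d: "0 < d" "d + 1 \<le> N"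
    and L: "L > 0" and \<epsilon>: "\<epsilon> > 0" and s: "s \<ge> 0"
    and B: "B = k / 4 + 2 * L"
    and G: "0 \<le> G" "\<epsilon> * s\<^sup>2 - k * s \<le> G" and A: "A \<le> L * s" and H: "H \<le> L * s" and T: "0 < T"
  shows "T * (- (a - a\<^sup>2 / N) * G + a * (d + 1) / N * A + a * H - \<kappa>) + (2 - 4 * a / N) * Q
    \<le> T * (- (3 / 4) * \<kappa> - a / 4 * G - a * \<epsilon> / 8 * s\<^sup>2) + 2 * \<bar>Q\<bar>"
proof -
  have N: "N > 0" using a by simp
  have "a\<^sup>2 / N \<le> a / 2"
    using a N by (simp add: power2_eq_square divide_le_eq)
  then have "- (a - a\<^sup>2 / N) \<le> - (a / 2)" by linarith
  then have "- (a - a\<^sup>2 / N) * G \<le> - (a / 2) * G"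
    using G(1) by (rule mult_right_mono)
  moreover have "a / 4 * (\<epsilon> * s\<^sup>2 - k * s) \<le> a / 4 * G"
    using a G by (intro mult_left_mono) auto
  moreover have "a * (d + 1) / N * A \<le> a * L * s"
  proof -
    have "a * (d + 1) / N * A \<le> a * (d + 1) / N * (L * s)"
      using a d N A by (intro mult_left_mono) auto
    also have "\<dots> \<le> a * (L * s)"
      using a d N L s by (intro mult_right_mono) (auto simp: divide_le_eq)
    finally show ?thesis by simp
  qed
  moreover have "a * H \<le> a * L * s"
    using a H by simp
  moreover have "a * B * s \<le> a * \<epsilon> / 8 * s\<^sup>2 + \<kappa> / 4"
  proof -
    have "0 \<le> a * (\<epsilon> * s - 4 * B)\<^sup>2 / (8 * \<epsilon>)"
      using a \<epsilon> by simp
    also have "\<dots> = a * \<epsilon> / 8 * s\<^sup>2 - a * B * s + 2 * a * B\<^sup>2 / \<epsilon>"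
      using \<epsilon> by (simp add: field_simps power2_eq_square)
    finally have "a * B * s \<le> a * \<epsilon> / 8 * s\<^sup>2 + 2 * a * B\<^sup>2 / \<epsilon>" by simp
    moreover have "2 * a * B\<^sup>2 / \<epsilon> \<le> \<kappa> / 4"
      using a(3) \<epsilon> by (simp add: divide_le_eq)
    ultimately show ?thesis by linarith
  qed
  moreover have "a / 4 * (\<epsilon> * s\<^sup>2 - k * s) = a * \<epsilon> / 4 * s\<^sup>2 - a * B * s + 2 * (a * L * s)"
    by (simp add: B algebra_simps)
  ultimately have "- (a - a\<^sup>2 / N) * G + a * (d + 1) / N * A + a * H - \<kappa>
      \<le> - (3 / 4) * \<kappa> - a / 4 * G - a * \<epsilon> / 8 * s\<^sup>2"
    by (simp add: algebra_simps)
  then have "T * (- (a - a\<^sup>2 / N) * G + a * (d + 1) / N * A + a * H - \<kappa>)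
      \<le> T * (- (3 / 4) * \<kappa> - a / 4 * G - a * \<epsilon> / 8 * s\<^sup>2)"
    using T by (intro mult_left_mono) auto
  moreover have "(2 - 4 * a / N) * Q \<le> 2 * \<bar>Q\<bar>"
  proof -
    have "0 < 4 * a / N" "4 * a / N < 2" using a N by (auto simp: divide_less_eq)
    then have "\<bar>2 - 4 * a / N\<bar> \<le> 2" by linarith
    then have "\<bar>2 - 4 * a / N\<bar> * \<bar>Q\<bar> \<le> 2 * \<bar>Q\<bar>"
      by (rule mult_right_mono) simp
    then show ?thesis
      using abs_ge_self[of "(2 - 4 * a / N) * Q"] by (simp add: abs_mult)
  qed
  ultimately show ?thesis by linarith
qed

text \<open>
  The cross term \<open>Q\<close> has no small factor \<open>a\<close>, so it is only absorbed outside a compact set that depends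
  on \<open>a\<close>: either \<open>T\<close> is large, and a small constant weight makes it small relative to \<open>T\<close>, or
  the bound \<open>2 |Q| \<le> 2 L s T\<close> is absorbed by \<open>s\<^sup>2\<close> up to a constant that the large dissipation pays for.\<close>

lemma cross_term_bounds:
  fixes a L \<epsilon> \<kappa> s T Q G :: real
  assumes a: "0 < a" and L: "L > 0" and \<epsilon>: "\<epsilon> > 0" and \<kappa>: "\<kappa> > 0"
    and T: "0 < T" and s: "1 \<le> s * T" and G: "0 \<le> G"
    and Q: "\<And>\<theta>. \<theta> > 0 \<Longrightarrow> 2 * \<bar>Q\<bar> \<le> L * (\<theta> * T + s / \<theta>)"
  shows "2 * \<bar>Q\<bar> \<le> T * (2 * L * s)"
    and "64 * L\<^sup>2 / \<kappa>\<^sup>2 + 64 * L\<^sup>2 / (\<kappa> * a * \<epsilon>) \<le> T \<or> a / 4 * G \<ge> 8 * L\<^sup>2 / (a * \<epsilon>)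
      \<Longrightarrow> 2 * \<bar>Q\<bar> \<le> T * (a / 4 * G + a * \<epsilon> / 8 * s\<^sup>2 + \<kappa> / 4)"
proof -
  have s0: "s > 0"
    using s T by (smt (verit) mult_nonpos_nonneg)
  have "2 * \<bar>Q\<bar> \<le> L * (s * T + s / s)"
    by (rule Q[OF s0])
  also have "\<dots> \<le> L * (s * T + s * T)"
  proof (rule mult_left_mono)
    have "s / s = 1" using s0 by simp
    with s show "s * T + s / s \<le> s * T + s * T" by linarith
  qed (use L in simp)
  finally show linear: "2 * \<bar>Q\<bar> \<le> T * (2 * L * s)"
    by (simp add: algebra_simps)
  assume "64 * L\<^sup>2 / \<kappa>\<^sup>2 + 64 * L\<^sup>2 / (\<kappa> * a * \<epsilon>) \<le> T \<or> a / 4 * G \<ge> 8 * L\<^sup>2 / (a * \<epsilon>)"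
  then show "2 * \<bar>Q\<bar> \<le> T * (a / 4 * G + a * \<epsilon> / 8 * s\<^sup>2 + \<kappa> / 4)"
  proof
    assume large: "64 * L\<^sup>2 / \<kappa>\<^sup>2 + 64 * L\<^sup>2 / (\<kappa> * a * \<epsilon>) \<le> T"
    have nn: "0 \<le> 64 * L\<^sup>2 / \<kappa>\<^sup>2" "0 \<le> 64 * L\<^sup>2 / (\<kappa> * a * \<epsilon>)"
      using a \<epsilon> \<kappa> by auto
    have "64 * L\<^sup>2 / \<kappa>\<^sup>2 \<le> T" using large nn by linarith
    then have T1: "8 * L\<^sup>2 / \<kappa> \<le> T * (\<kappa> / 8)"
      using \<kappa> by (simp add: field_simps power2_eq_square)
    have "64 * L\<^sup>2 / (\<kappa> * a * \<epsilon>) \<le> T" using large nn by linarith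
    then have T2: "8 * L\<^sup>2 / \<kappa> \<le> T * (a * \<epsilon> / 8)"
      using \<kappa> a \<epsilon> by (simp add: field_simps power2_eq_square)
    have "0 \<le> (s - 1)\<^sup>2 + s" using s0 by simp
    then have "s \<le> 1 + s\<^sup>2"
      by (simp add: power2_eq_square algebra_simps)
    then have "8 * L\<^sup>2 / \<kappa> * s \<le> 8 * L\<^sup>2 / \<kappa> * (1 + s\<^sup>2)"
      using \<kappa> by (intro mult_left_mono) auto
    also have "\<dots> = 8 * L\<^sup>2 / \<kappa> + 8 * L\<^sup>2 / \<kappa> * s\<^sup>2"
      by (simp only: distrib_left mult_1_right)
    also have "\<dots> \<le> T * (\<kappa> / 8) + T * (a * \<epsilon> / 8) * s\<^sup>2"
      by (intro add_mono T1 mult_right_mono T2) simp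
    finally have "8 * L\<^sup>2 / \<kappa> * s \<le> T * (\<kappa> / 8) + T * (a * \<epsilon> / 8) * s\<^sup>2" .
    moreover have "2 * \<bar>Q\<bar> \<le> T * (\<kappa> / 8) + 8 * L\<^sup>2 / \<kappa> * s"
    proof -
      have "L * (\<kappa> / (8 * L) * T + s / (\<kappa> / (8 * L))) = T * (\<kappa> / 8) + 8 * L\<^sup>2 / \<kappa> * s"
        using \<kappa> L by (simp add: field_simps power2_eq_square)
      then show ?thesis
        using Q[of "\<kappa> / (8 * L)"] \<kappa> L by simp
    qed
    moreover have "0 \<le> T * (a / 4 * G)"
      using T a G by simp
    ultimately show ?thesis by (simp add: algebra_simps)
  next
    assume G_large: "a / 4 * G \<ge> 8 * L\<^sup>2 / (a * \<epsilon>)"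
    have "0 \<le> (a * \<epsilon> * s - 8 * L)\<^sup>2 / (8 * a * \<epsilon>)"
      using a \<epsilon> by simp
    also have "\<dots> = a * \<epsilon> / 8 * s\<^sup>2 - 2 * L * s + 8 * L\<^sup>2 / (a * \<epsilon>)"
      using a \<epsilon> by (simp add: field_simps power2_eq_square)
    finally have "2 * L * s \<le> a * \<epsilon> / 8 * s\<^sup>2 + 8 * L\<^sup>2 / (a * \<epsilon>)" by simp
    then have "2 * L * s \<le> a / 4 * G + a * \<epsilon> / 8 * s\<^sup>2 + \<kappa> / 4"
      using G_large \<kappa> by linarith
    then have "T * (2 * L * s) \<le> T * (a / 4 * G + a * \<epsilon> / 8 * s\<^sup>2 + \<kappa> / 4)"
      using T by (intro mult_left_mono) auto
    with linear show ?thesis by linarith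
  qed
qed


theorem theorem1:
  fixes f :: "real^'d \<Rightarrow> real" and L :: real
  assumes "CARD('n::finite) \<ge> CARD('d) + 3"
    and "\<And>x. f x \<ge> 0"
    and "C2 f"
    and "L > 0" and "\<And>x. op_norm (hessian f x) \<le> L"
    and "\<exists>\<mu>>0. \<exists>B. compact B \<and> (\<forall>x. x \<notin> B \<longrightarrow> hessian f x \<succeq> \<mu> *\<^sub>R mat 1)"
  shows "\<exists>a\<^sub>0>0. \<forall>a. 0 < a \<and> a < a\<^sub>0 \<longrightarrow>
    (\<exists>c>0. \<exists>b. \<exists>K :: (real^'d^'n) set. compact K \<and> K \<subseteq> state_space \<and>
      (\<forall>X\<in>state_space.
        generator f (lyapunov f a) X \<le> - c * lyapunov f a X + b * indicator K X))"
proof -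
  note f = \<open>C2 f\<close> and L = \<open>L > 0\<close> and hess = assms(5)
  obtain \<mu> B where \<mu>: "\<mu> > 0" and B: "compact B" "\<And>x. x \<notin> B \<Longrightarrow> hessian f x \<succeq> \<mu> *\<^sub>R mat 1"
    using assms(6) by blast
  obtain c where c: "c \<ge> 0" and mono:
    "\<And>x y. (gradient f x - gradient f y) \<bullet> (x - y) \<ge> \<mu> / 2 * (norm (x - y))\<^sup>2 - c"
    using gradient_monotone_up_to_constant[OF f hess L \<mu> B] by blast
  note lip = gradient_lipschitz[OF f hess]
  define N where "N = real CARD('n)"
  define d where "d = real CARD('d)"
  define \<kappa> where "\<kappa> = 2 * (N - d - 2) / N"
  define \<epsilon> where "\<epsilon> = (\<mu> / 2)\<^sup>2 / d"
  define k where "k = 2 * (\<mu> / 2) * c / d"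
  define \<beta> where "\<beta> = k / 4 + 2 * L"
  define e where "e = \<mu>\<^sup>2 / 8"
  define l where "l = \<mu> * c / 2 + (norm (gradient f 0))\<^sup>2"
  have d: "d \<ge> 1" by (simp add: d_def Suc_leI)
  have Nd: "N \<ge> d + 3" using assms(1) by (simp add: N_def d_def)
  have N: "N > 0" using Nd d by simp
  have \<kappa>: "\<kappa> > 0" using Nd N by (simp add: \<kappa>_def)
  have \<epsilon>: "\<epsilon> > 0" using \<mu> d by (simp add: \<epsilon>_def)
  have \<beta>: "\<beta> > 0" using \<mu> c d L by (simp add: \<beta>_def k_def add_nonneg_pos)
  have e: "e > 0" using \<mu> by (simp add: e_def)
  have l: "l \<ge> 0" using \<mu> c by (simp add: l_def)
  have coercive: "(norm (gradient f x))\<^sup>2 \<ge> e * (norm x)\<^sup>2 - l" for x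
    unfolding e_def l_def by (rule gradient_coercive[OF \<mu> mono])
  show ?thesis
  proof (rule exI[of _ "min (N / 2) (\<kappa> * \<epsilon> / (8 * \<beta>\<^sup>2))"], intro conjI allI impI)
    show "0 < min (N / 2) (\<kappa> * \<epsilon> / (8 * \<beta>\<^sup>2))"
      using N \<kappa> \<epsilon> \<beta> by simp
    fix a :: real
    assume "0 < a \<and> a < min (N / 2) (\<kappa> * \<epsilon> / (8 * \<beta>\<^sup>2))"
    then have a: "0 < a" "a < N / 2" "8 * a * \<beta>\<^sup>2 \<le> \<kappa> * \<epsilon>"
      using \<beta> by (auto simp: field_simps)
    \<comment> \<open>a trace above \<open>R'\<close> makes the cross term small; \<open>V\<close> is the excess of the cross term over its
      quadratic compensation, and beyond radius \<open>R\<close> the kept dissipation \<open>a / 4 * G\<close> exceeds \<open>V\<close> unless the trace is above \<open>R'\<close>\<close>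
    define R' where "R' = 64 * L\<^sup>2 / \<kappa>\<^sup>2 + 64 * L\<^sup>2 / (\<kappa> * a * \<epsilon>)"
    define V where "V = 8 * L\<^sup>2 / (a * \<epsilon>)"
    define R where "R = 1 + N * (l + R' * (4 * V / a)) / e"
    define K where "K = {X :: real^'d^'n. X \<in> state_space \<and> norm X \<le> R \<and> trace (precision X) \<le> R'}"
    have R': "R' > 0" unfolding R'_def using a L \<kappa> \<epsilon> by (intro add_pos_pos divide_pos_pos) auto
    have V: "V > 0" unfolding V_def using a L \<epsilon> by simp
    have K: "compact K" "K \<subseteq> state_space"
      unfolding K_def by (rule compact_bounded_precision) auto
    have "continuous_on UNIV f"
      using f by (auto simp: C2_def intro: differentiable_imp_continuous_on)
    then have "continuous_on K (\<lambda>X. f (X $ j))" for j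
      by (rule continuous_on_compose2) (auto intro: continuous_on_component continuous_on_id)
    then have "continuous_on K (\<lambda>X. exp (a / N * (\<Sum>j\<in>UNIV. f (X $ j))))"
      by (intro continuous_on_exp continuous_on_mult_left continuous_on_sum)
    then have "bounded ((\<lambda>X. exp (a / N * (\<Sum>j\<in>UNIV. f (X $ j)))) ` K)"
      using K by (intro compact_imp_bounded compact_continuous_image)
    then obtain M where M: "\<And>X. X \<in> K \<Longrightarrow> exp (a / N * (\<Sum>j\<in>UNIV. f (X $ j))) \<le> M"
      by (auto simp: bounded_iff)
    have drift: "generator f (lyapunov f a) X
        \<le> - (\<kappa> / 2) * lyapunov f a X + (\<kappa> / 2 + V) * (M * R') * indicator K X"
      if X: "X \<in> state_space" for X :: "real^'d^'n"
    proof -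
      define T where "T = trace (precision X)"
      define s where "s = avg (\<lambda>i. dev X i \<bullet> dev X i)"
      define G where "G = avg (\<lambda>i. gradient f (X $ i) \<bullet> (ens_cov X *v gradient f (X $ i)))"
      define A where "A = avg (\<lambda>i. gradient f (X $ i) \<bullet> dev X i)"
      define H where "H = avg (\<lambda>i. ens_cov X :\<^sub>F hessian f (X $ i))"
      define Q where "Q = avg (\<lambda>i. gradient f (X $ i) \<bullet> pdev X i)"
      define E where "E = exp (a / N * (\<Sum>i\<in>UNIV. f (X $ i)))"
      define Y where "Y = T * (- (a - a\<^sup>2 / N) * G + a * (d + 1) / N * A + a * H - \<kappa>)
        + (2 - 4 * a / N) * Q"
      have gen: "generator f (lyapunov f a) X = E * Y"
        unfolding Y_def \<kappa>_def E_def T_def G_def A_def H_def Q_def N_def d_def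
        by (rule generator_lyapunov[OF f X])
      have lyap: "lyapunov f a X = E * T"
        by (simp add: lyapunov_def E_def T_def N_def precision_def)
      have T: "T > 0" unfolding T_def by (rule trace_precision_pos[OF X])
      have s: "s \<ge> 0" by (simp add: s_def avg_nonneg)
      have E: "E > 0" by (simp add: E_def)
      have "1 \<le> d\<^sup>2" using d by simp
      then have sT: "1 \<le> s * T"
        using spread_trace_precision[OF X] unfolding s_def T_def d_def by (rule order.trans)
      have G: "0 \<le> G"
        unfolding G_def by (intro avg_nonneg) (simp add: inner_ens_cov avg_nonneg)
      have H: "H \<le> L * s"
      proof -
        have "ens_cov X :\<^sub>F hessian f (X $ i) \<le> L * s" for i
          unfolding frobenius_ens_cov s_def avg_cmult[symmetric]
          using hessian_quadratic_bound[OF hess[of "X $ i"]] by (intro avg_mono) (simp add: abs_le_iff)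
        then have "H \<le> avg (\<lambda>i::'n. L * s)"
          unfolding H_def by (intro avg_mono)
        then show ?thesis by simp
      qed
      have A: "A \<le> L * s"
        unfolding A_def s_def by (rule avg_gradient_dev_bounds(1)[OF lip mono])
      have G_quadratic: "\<epsilon> * s\<^sup>2 - k * s \<le> G"
        unfolding \<epsilon>_def k_def s_def G_def d_def
        using \<mu> by (intro avg_force_quadratic_lower_bound[OF X _ mono lip]) simp
      have Y_le: "Y \<le> T * (- (3 / 4) * \<kappa> - a / 4 * G - a * \<epsilon> / 8 * s\<^sup>2) + 2 * \<bar>Q\<bar>"
        unfolding Y_def
        using d Nd
        by (intro relative_generator_bound[OF a _ _ L \<epsilon> s \<beta>_def G G_quadratic A H T]) auto
      have Q: "2 * \<bar>Q\<bar> \<le> L * (\<theta> * T + s / \<theta>)" if "\<theta> > 0" for \<theta>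
        unfolding Q_def T_def s_def using L that by (intro avg_gradient_pdev_bound[OF X lip]) auto
      note cross = cross_term_bounds[OF a(1) L \<epsilon> \<kappa> T sT G Q]
      show ?thesis
      proof (cases "X \<in> K")
        case True
        have "0 \<le> (a * \<epsilon> * s - 8 * L)\<^sup>2 / (8 * a * \<epsilon>)"
          using a \<epsilon> by simp
        also have "\<dots> = a * \<epsilon> / 8 * s\<^sup>2 - 2 * L * s + V"
          using a \<epsilon> by (simp add: V_def field_simps power2_eq_square)
        finally have "T * (2 * L * s) \<le> T * (a * \<epsilon> / 8 * s\<^sup>2 + V)"
          using T by (intro mult_left_mono) auto
        moreover have "0 \<le> T * (a / 4 * G)" "0 \<le> T * \<kappa>"
          using T a G \<kappa> by auto
        ultimately have "Y \<le> T * V"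
          using Y_le cross(1) by (simp add: algebra_simps)
        then have "E * Y \<le> E * (T * V)"
          using E by (intro mult_left_mono) auto
        moreover have "(\<kappa> / 2 + V) * (E * T) \<le> (\<kappa> / 2 + V) * (M * R')"
        proof (intro mult_left_mono mult_mono)
          show EM: "E \<le> M" unfolding E_def by (rule M[OF True])
          show "0 \<le> M" using EM E by linarith
          show "T \<le> R'" using True by (simp add: K_def T_def)
        qed (use T \<kappa> V in auto)
        ultimately show ?thesis
          using True by (simp add: gen lyap algebra_simps)
      next
        case False
        \<comment> \<open>an ensemble outside \<open>K\<close> is nearly degenerate or far from the origin\<close>
        have "R' \<le> T \<or> a / 4 * G \<ge> V"
        proof (rule disjCI)
          assume "\<not> a / 4 * G \<ge> V"
          then have "G < 4 * V / a"
            using a by (simp add: field_simps)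
          show "R' \<le> T"
          proof (rule ccontr)
            assume "\<not> R' \<le> T"
            then have TR: "T \<le> R'" "norm X > R"
              using False X by (auto simp: K_def T_def)
            have R: "R \<ge> 1"
              unfolding R_def using N l R' V a e by simp
            have "N * (l + R' * (4 * V / a)) / e < norm X"
              using TR(2) by (simp add: R_def)
            also have "norm X \<le> (norm X)\<^sup>2"
              using R TR(2) by (intro self_le_power) auto
            finally have "l + R' * (4 * V / a) < e * (norm X)\<^sup>2 / N"
              using e N by (simp add: field_simps)
            also have "\<dots> \<le> l + T * G"
              using avg_force_coercive[OF X coercive] by (simp add: T_def G_def N_def)
            also have "T * G \<le> R' * (4 * V / a)"
              using TR(1) \<open>G < 4 * V / a\<close> G R' by (intro mult_mono) auto
            finally show False by simp
          qed
        qed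
        then have "2 * \<bar>Q\<bar> \<le> T * (a / 4 * G + a * \<epsilon> / 8 * s\<^sup>2 + \<kappa> / 4)"
          unfolding R'_def V_def by (rule cross(2)[rotated])
        then have "Y \<le> - (\<kappa> / 2) * T"
          using Y_le by (simp add: algebra_simps)
        then have "E * Y \<le> E * (- (\<kappa> / 2) * T)"
          using E by (intro mult_left_mono) auto
        then show ?thesis
          using False by (simp add: gen lyap mult_ac)
      qed
    qed
    have "0 < \<kappa> / 2" using \<kappa> by simp
    with K drift show "\<exists>c>0. \<exists>b. \<exists>K :: (real^'d^'n) set. compact K \<and> K \<subseteq> state_space \<and>
      (\<forall>X\<in>state_space.
        generator f (lyapunov f a) X \<le> - c * lyapunov f a X + b * indicator K X)"
      by blast
  qed
qed

end
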